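(* Let $\lambda$ be a measure with steep cumulant generating function $\kappa$, and let $\Theta_0$, $M_0$, $\{P_{\boldsymbol\theta}\}_{\boldsymbol\theta\in\Theta_0}$ be as in the context. Let $\boldsymbol\theta_0\in \mathrm{int}(\Theta_0)$, let $\boldsymbol x_1,\boldsymbol x_2,\ldots$ be i.i.d. with law $P_{\boldsymbol\theta_0}$, let $\bar{\boldsymbol x}_n=\frac1n\sum_{i=1}^n\boldsymbol x_i$, and suppose that, for every $n$, $\bar{\boldsymbol x}_n$ takes values in $M_0$ almost surely. Let $\Theta\subset\Theta_0$ be a relatively closed subset of $\Theta_0$, and suppose that there exists a continuous function $\varphi_\Theta:M_0\to\Theta\cap \mathrm{int}(\Theta_0)$ which is a maximum likelihood estimator constrained to $\Theta$. Then the sequence of laws of $\{\varphi_\Theta(\bar{\boldsymbol x}_n)\}_{n\in\mathbb N}$ satisfies a large deviation principle with rate function $$I(\boldsymbol\theta)=\inf\{D(\boldsymbol\theta'||\boldsymbol\theta_0):\boldsymbol\theta'\in T_{\boldsymbol\theta}(\Theta)\},\qquad \boldsymbol\theta\in\Theta\cap \mathrm{int}(\Theta_0),$$ where $T_{\boldsymbol\theta}(\Theta)=\{\boldsymbol\theta'\in \mathrm{int}(\Theta_0):\varphi_\Theta(\nabla\kappa(\boldsymbol\theta'))=\boldsymbol\theta\}$ (and $\inf\emptyset=+\infty$).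
   Context: Setting: $\lambda$ is a $\sigma$-finite Borel measure on $\mathbb R^d$, not concentrated on a proper affine submanifold of $\mathbb R^d$. Its cumulant generating function is $\kappa(\boldsymbol\theta)=\log\int_{\mathbb R^d}e^{\boldsymbol\theta\cdot\boldsymbol x}\lambda(d\boldsymbol x)\in(-\infty,+\infty]$, with domain of finiteness $\Theta_0=\{\boldsymbol\theta:\kappa(\boldsymbol\theta)<\infty\}$ (not required to be open). $\kappa$ is assumed steep: $\Theta_0$ has non-empty interior and, for any $\boldsymbol\theta\in\partial\Theta_0$ and any sequence $\{\boldsymbol\theta_n\}\subset \mathrm{int}(\Theta_0)$ converging to $\boldsymbol\theta$, $\|\nabla\kappa(\boldsymbol\theta_n)\|\to\infty$. The exponential family is $\frac{dP_{\boldsymbol\theta}}{d\lambda}(\boldsymbol x)=e^{\boldsymbol\theta\cdot\boldsymbol x-\kappa(\boldsymbol\theta)}$, $\boldsymbol\theta\in\Theta_0$. $M_0$ is the interior of the convex support $C(\lambda)$ of $\lambda$ (smallest closed convex set whose complement is $\lambda$-null); $\nabla\kappa$ is a bijection of $\mathrm{int}(\Theta_0)$ onto $M_0$ with inverse $\nabla\kappa^*$, where $\kappa^*(\boldsymbol t)=\sup_{\boldsymbol\theta}\{\boldsymbol\theta\cdot\boldsymbol t-\kappa(\boldsymbol\theta)\}$ is the convex conjugate. $D(\boldsymbol\theta_1||\boldsymbol\theta_2)=\int\log\frac{dP_{\boldsymbol\theta_1}}{dP_{\boldsymbol\theta_2}}\,dP_{\boldsymbol\theta_1}$ is the Kullback-Leibler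 divergence of $P_{\boldsymbol\theta_1}$ with respect to $P_{\boldsymbol\theta_2}$. An $m$-projection of $\boldsymbol\theta_1$ on $\Theta$ is any minimizer of $\boldsymbol\theta\mapsto D(\boldsymbol\theta_1||\boldsymbol\theta)$ over $\boldsymbol\theta\in\Theta$. A maximum likelihood estimator (MLE) constrained to $\Theta$ is a Borel function $\varphi_\Theta$ on $M_0$ such that, for every $\boldsymbol t\in M_0$, $\varphi_\Theta(\boldsymbol t)$ is an $m$-projection of $\nabla\kappa^*(\boldsymbol t)$ on $\Theta$ (equivalently, a maximizer over $\boldsymbol\theta\in\Theta$ of $\boldsymbol\theta\cdot\boldsymbol t-\kappa(\boldsymbol\theta)$). A sequence $\{\phi_n\}$ of probability measures on a topological space $\mathcal X$ satisfies the large deviation principle (LDP) with rate function $I:\mathcal X\to[0,+\infty]$ if $I$ is lower semi-continuous with compact sub-level sets $\{I\le\eta\}$, $\eta\ge0$ (all rate functions are good), and for every Borel $A\subset\mathcal X$, $-\inf_{\mathrm{int}(A)}I\le\liminf_n n^{-1}\ln\phi_n(A)\le\limsup_n n^{-1}\ln\phi_n(A)\le-\inf_{\bar A}I$. Here $\mathcal X=\Theta\cap \mathrm{int}(\Theta_0)$. *)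

theory Defs
  imports "HOL-Probability.Probability"
begin

section \<open>Large deviation principles\<close>

text \<open>The extended logarithm, with \<open>ln 0 = -\<infinity>\<close> and \<open>ln \<infinity> = \<infinity>\<close>.\<close>

definition ln_ereal :: "ennreal \<Rightarrow> ereal" where
  "ln_ereal x =
     (if x = 0 then -\<infinity> else if x = \<infinity> then \<infinity> else ereal (ln (enn2real x)))"

text \<open>All rate functions are good. Only the values of \<open>I\<close> on the points of \<open>T\<close> matter.\<close>

definition rate_function :: "'a topology \<Rightarrow> ('a \<Rightarrow> ereal) \<Rightarrow> bool" where
  "rate_function T I \<longleftrightarrow>
     (\<forall>x\<in>topspace T. 0 \<le> I x) \<and>
     (\<forall>c. openin T {x \<in> topspace T. c < I x}) \<and>
     (\<forall>\<eta>::real. 0 \<le> \<eta> \<longrightarrow> compactin T {x \<in> topspace T. I x \<le> ereal \<eta>})"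

text \<open>The sequence is indexed by \<open>n \<ge> 1\<close>: nothing is required of \<open>\<phi> 0\<close>.\<close>

definition large_deviation_principle ::
    "'a topology \<Rightarrow> (nat \<Rightarrow> 'a measure) \<Rightarrow> ('a \<Rightarrow> ereal) \<Rightarrow> bool" where
  "large_deviation_principle T \<phi> I \<longleftrightarrow>
     (\<forall>n\<ge>1. prob_space (\<phi> n) \<and> space (\<phi> n) = topspace T \<and>
        sets (\<phi> n) = sigma_sets (topspace T) {U. openin T U}) \<and>
     rate_function T I \<and>
     (\<forall>A \<in> sigma_sets (topspace T) {U. openin T U}.
        - (INF x \<in> T interior_of A. I x)
            \<le> liminf (\<lambda>n. ln_ereal (emeasure (\<phi> n) A) / ereal (real n)) \<and>
        liminf (\<lambda>n. ln_ereal (emeasure (\<phi> n) A) / ereal (real n))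
            \<le> limsup (\<lambda>n. ln_ereal (emeasure (\<phi> n) A) / ereal (real n)) \<and>
        limsup (\<lambda>n. ln_ereal (emeasure (\<phi> n) A) / ereal (real n))
            \<le> - (INF x \<in> T closure_of A. I x))"

section \<open>Exponential families\<close>

definition grad :: "('a::euclidean_space \<Rightarrow> real) \<Rightarrow> 'a \<Rightarrow> 'a" where
  "grad f x = (THE D. GDERIV f x :> D)"

definition cumulant :: "'a::euclidean_space measure \<Rightarrow> 'a \<Rightarrow> ereal" where
  "cumulant L \<theta> = ln_ereal (\<integral>\<^sup>+ x. ennreal (exp (\<theta> \<bullet> x)) \<partial>L)"

definition finite_domain :: "'a::euclidean_space measure \<Rightarrow> 'a set" where
  "finite_domain L = {\<theta>. cumulant L \<theta> < \<infinity>}"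

definition grad_cumulant :: "'a::euclidean_space measure \<Rightarrow> 'a \<Rightarrow> 'a" where
  "grad_cumulant L = grad (\<lambda>\<theta>. real_of_ereal (cumulant L \<theta>))"

definition cumulant_conjugate :: "'a::euclidean_space measure \<Rightarrow> 'a \<Rightarrow> ereal" where
  "cumulant_conjugate L t = (SUP \<theta>. ereal (\<theta> \<bullet> t) - cumulant L \<theta>)"

definition grad_conjugate :: "'a::euclidean_space measure \<Rightarrow> 'a \<Rightarrow> 'a" where
  "grad_conjugate L = grad (\<lambda>t. real_of_ereal (cumulant_conjugate L t))"

definition steep :: "'a::euclidean_space measure \<Rightarrow> bool" where
  "steep L \<longleftrightarrow>
     interior (finite_domain L) \<noteq> {} \<and>
     (\<forall>\<theta> \<in> frontier (finite_domain L). \<forall>s :: nat \<Rightarrow> 'a.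
        (\<forall>n. s n \<in> interior (finite_domain L)) \<longrightarrow> s \<longlonglongrightarrow> \<theta> \<longrightarrow>
        filterlim (\<lambda>n. norm (grad_cumulant L (s n))) at_top sequentially)"

text \<open>Affine sets of a Euclidean space are closed, so their complements are measurable.\<close>

definition not_affinely_concentrated :: "'a::euclidean_space measure \<Rightarrow> bool" where
  "not_affinely_concentrated L \<longleftrightarrow>
     (\<forall>S. affine S \<and> S \<noteq> UNIV \<longrightarrow> emeasure L (- S) \<noteq> 0)"

text \<open>The lemmas below show that this is indeed the smallest closed convex set whose
  complement is null.\<close>

definition convex_support :: "'a::euclidean_space measure \<Rightarrow> 'a set" where
  "convex_support L = \<Inter>{C. closed C \<and> convex C \<and> emeasure L (- C) = 0}"

lemma closed_convex_support: "closed (convex_support L)"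
  unfolding convex_support_def by (rule closed_Inter) blast

lemma convex_convex_support: "convex (convex_support L)"
  unfolding convex_support_def by (rule convex_Inter) blast

lemma convex_support_subset:
  "closed C \<Longrightarrow> convex C \<Longrightarrow> emeasure L (- C) = 0 \<Longrightarrow> convex_support L \<subseteq> C"
  unfolding convex_support_def by (rule Inter_lower) blast

lemma emeasure_compl_convex_support:
  fixes L :: "'a::euclidean_space measure"
  assumes "sets L = sets borel"
  shows "emeasure L (- convex_support L) = 0"
proof -
  define G where "G = {C. closed C \<and> convex C \<and> emeasure L (- C) = 0}"
  have op: "open (- C)" and null: "- C \<in> null_sets L" if C: "C \<in> G" for C
  proof -
    have "closed C" "emeasure L (- C) = 0"
      using C unfolding G_def by blast+
    show "open (- C)"
      using \<open>closed C\<close> by (rule open_Compl)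
    with \<open>emeasure L (- C) = 0\<close> show "- C \<in> null_sets L"
      using assms borel_open by (intro null_setsI) auto
  qed
  obtain F' where F': "F' \<subseteq> uminus ` G" "countable F'" "\<Union>F' = \<Union>(uminus ` G)"
    by (rule Lindelof[of "uminus ` G"]) (use op in blast)+
  have "(\<Union>S\<in>F'. S) \<in> null_sets L"
    by (rule null_sets_UN'[OF F'(2)]) (use F'(1) null in blast)
  moreover have "- convex_support L = (\<Union>S\<in>F'. S)"
    unfolding image_ident F'(3) convex_support_def G_def[symmetric] by blast
  ultimately show ?thesis
    by (metis null_setsD1)
qed

definition mean_domain :: "'a::euclidean_space measure \<Rightarrow> 'a set" where
  "mean_domain L = interior (convex_support L)"

definition exp_family :: "'a::euclidean_space measure \<Rightarrow> 'a \<Rightarrow> 'a measure" where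
  "exp_family L \<theta> =
     density L (\<lambda>x. ennreal (exp (\<theta> \<bullet> x - real_of_ereal (cumulant L \<theta>))))"

text \<open>\<open>KL_divergence b M N\<close> is the divergence of \<open>N\<close> with respect to \<open>M\<close>, so the arguments
  are swapped. It is a Bochner integral, hence real-valued; below it is only used with
  \<open>\<theta>1\<close> interior to \<open>finite_domain L\<close> and \<open>\<theta>2\<close> in \<open>finite_domain L\<close>, where the
  log-likelihood ratio is affine and therefore integrable.\<close>

definition kl_div :: "'a::euclidean_space measure \<Rightarrow> 'a \<Rightarrow> 'a \<Rightarrow> real" where
  "kl_div L \<theta>1 \<theta>2 = KL_divergence (exp 1) (exp_family L \<theta>2) (exp_family L \<theta>1)"

definition m_projection :: "'a::euclidean_space measure \<Rightarrow> 'a set \<Rightarrow> 'a \<Rightarrow> 'a \<Rightarrow> bool" where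
  "m_projection L \<Theta> \<theta>1 \<theta> \<longleftrightarrow>
     \<theta> \<in> \<Theta> \<and> (\<forall>\<theta>'\<in>\<Theta>. kl_div L \<theta>1 \<theta> \<le> kl_div L \<theta>1 \<theta>')"

text \<open>An estimator is a function on \<open>mean_domain L\<close>; its values elsewhere are irrelevant.\<close>

definition constrained_MLE ::
    "'a::euclidean_space measure \<Rightarrow> 'a set \<Rightarrow> ('a \<Rightarrow> 'a) \<Rightarrow> bool" where
  "constrained_MLE L \<Theta> \<phi> \<longleftrightarrow>
     \<phi> \<in> borel_measurable (restrict_space borel (mean_domain L)) \<and>
     (\<forall>t \<in> mean_domain L. m_projection L \<Theta> (grad_conjugate L t) (\<phi> t))"

definition T_set :: "'a::euclidean_space measure \<Rightarrow> ('a \<Rightarrow> 'a) \<Rightarrow> 'a \<Rightarrow> 'a set" where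
  "T_set L \<phi> \<theta> = {\<theta>' \<in> interior (finite_domain L). \<phi> (grad_cumulant L \<theta>') = \<theta>}"

text \<open>In \<open>ereal\<close> the infimum over the empty set is \<open>\<infinity>\<close>.\<close>

definition mle_rate ::
    "'a::euclidean_space measure \<Rightarrow> 'a \<Rightarrow> ('a \<Rightarrow> 'a) \<Rightarrow> 'a \<Rightarrow> ereal" where
  "mle_rate L \<theta>0 \<phi> \<theta> = (INF \<theta>' \<in> T_set L \<phi> \<theta>. ereal (kl_div L \<theta>' \<theta>0))"

section \<open>Laws of the estimator\<close>

text \<open>The sample is \<open>X 0, X 1, \<dots>\<close>; the mean of the first \<open>n\<close> observations is meaningful for
  \<open>n \<ge> 1\<close>.\<close>

definition sample_mean :: "(nat \<Rightarrow> 'w \<Rightarrow> 'a::real_vector) \<Rightarrow> nat \<Rightarrow> 'w \<Rightarrow> 'a" where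
  "sample_mean X n \<omega> = (1 / real n) *\<^sub>R (\<Sum>i<n. X i \<omega>)"

text \<open>The sample mean lies in \<open>mean_domain L\<close> only almost surely, whereas \<open>\<phi>\<close> is a function on
  \<open>mean_domain L\<close>. So the law of the sample mean is first regarded as a measure on
  \<open>mean_domain L\<close> (no mass is lost) and then pushed forward to the Borel space \<open>S\<close> by \<open>\<phi>\<close>.\<close>

definition estimator_law ::
    "'w measure \<Rightarrow> (nat \<Rightarrow> 'w \<Rightarrow> 'a::euclidean_space) \<Rightarrow> 'a measure \<Rightarrow> 'a set \<Rightarrow>
     ('a \<Rightarrow> 'a) \<Rightarrow> nat \<Rightarrow> 'a measure" where
  "estimator_law M X L S \<phi> n =
     distr (restrict_space (distr M borel (sample_mean X n)) (mean_domain L))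
       (restrict_space borel S) \<phi>"

end

theory Submission
  imports Defs
begin

text \<open>
The estimator is a continuous image of the sample mean, so the result is Cramer's theorem for the
sample mean, followed by the contraction principle along \<open>\<phi>\<close>. Two points need care: the large
deviation principle for the sample mean has to live on the open set \<open>M\<^sub>0 = mean_domain L\<close>, where \<open>\<phi>\<close> is
defined, and its rate has to be recognised as a Kullback-Leibler divergence.

\<^bold>\<open>Cramer's theorem.\<close> All that is used of the law of the sample mean of size \<open>n\<close> is
that the integral of \<open>exp (n * (\<xi> \<bullet> x))\<close> is \<open>exp (n * \<Lambda> \<xi>)\<close> with \<open>\<Lambda> \<xi> = \<kappa> (\<theta>0 + \<xi>) - \<kappa> \<theta>0\<close>; the
locale \<open>exponential_moments\<close> abstracts this. The rate is the conjugate
\<open>rate t = sup (\<xi> \<bullet> t - \<Lambda> \<xi>)\<close>. By Markov's inequality each half-space where \<open>\<xi> \<bullet> x - \<Lambda> \<xi>\<close> exceeds \<open>\<eta>\<close>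
has mass at most \<open>exp (- n * \<eta>)\<close>, and finitely many such half-spaces cover a closed set on which the
rate exceeds \<open>\<eta>\<close> (\<open>closed_bound\<close>). For the lower bound at \<open>t = \<nabla>\<Lambda>(\<xi>)\<close>, the laws are tilted by
\<open>exp (n * (\<xi> \<bullet> x - \<Lambda> \<xi>))\<close>. The tilted laws have exponential moments of the same kind, and
\<open>closed_bound\<close>, applied to them, shows that they concentrate at \<open>t\<close> (\<open>open_bound\<close>).

\<^bold>\<open>Restriction to \<open>M\<^sub>0\<close>.\<close> The sample mean of size one lies in \<open>M\<^sub>0\<close> almost surely, so \<open>L\<close> does not
charge the complement of \<open>M\<^sub>0\<close>. For \<open>t \<notin> M\<^sub>0\<close> some \<open>a\<close> satisfies \<open>a \<bullet> x < a \<bullet> t\<close> for \<open>L\<close>-almost all \<open>x\<close>,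
and letting \<open>\<xi>\<close> run to infinity in the direction \<open>a\<close> gives \<open>rate t = \<infinity>\<close>
(\<open>conjugate_infinite_outside_mean_domain\<close>). Hence the compact sub-level sets of the rate are contained
in \<open>M\<^sub>0\<close>; this makes the rate good on \<open>M\<^sub>0\<close> and allows the contraction principle
(\<open>large_deviations_continuous_image\<close>).

\<^bold>\<open>Identification of the rate.\<close> The gradient of \<open>\<kappa>\<close> at an interior point \<open>\<theta>\<close> is the mean of \<open>P\<^sub>\<theta>\<close>, and
the tangent inequality for \<open>\<kappa>\<close> at \<open>\<theta>\<close> shows that the supremum defining the rate at \<open>t = \<nabla>\<kappa>(\<theta>)\<close> is
attained at \<open>\<xi> = \<theta> - \<theta>0\<close>, where its value is the divergence of \<open>P\<^sub>\<theta>\<close> from \<open>P\<close> at \<open>\<theta>0\<close>. Steepness enters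
through the surjectivity of \<open>\<nabla>\<kappa>\<close> onto \<open>M\<^sub>0\<close> (\<open>steep_mean_surjective\<close>): for \<open>t \<in> M\<^sub>0\<close> the function
\<open>\<kappa> \<theta> - \<theta> \<bullet> t\<close> is coercive and lower semicontinuous, so it has a minimizer, and steepness keeps the
minimizer away from the boundary of the domain. Thus minimising the rate over the fibre of \<open>\<phi>\<close>
above \<open>\<theta>\<close> is the same as minimising the divergence over \<open>T_set L \<phi> \<theta>\<close>.\<close>

section \<open>Exponential bounds from scaled moment generating functions\<close>

text \<open>The sequence \<open>\<mu>\<close> behaves like the laws of the means of independent
identically distributed vectors whose cumulant generating function is \<open>\<Lambda>\<close> on
\<open>D\<close>. The class is closed under exponential tilting, so the upper bound also applies to
the tilted laws of the lower bound.\<close>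

locale exponential_moments =
  fixes \<mu> :: "nat \<Rightarrow> 'a::euclidean_space measure" and D :: "'a set" and \<Lambda> :: "'a \<Rightarrow> real"
  assumes prob: "n \<ge> 1 \<Longrightarrow> prob_space (\<mu> n)"
    and sets_eq: "n \<ge> 1 \<Longrightarrow> sets (\<mu> n) = sets borel"
    and zero_interior: "0 \<in> interior D"
    and moment: "n \<ge> 1 \<Longrightarrow> \<xi> \<in> D \<Longrightarrow>
      (\<integral>\<^sup>+ x. ennreal (exp (real n * (\<xi> \<bullet> x))) \<partial>\<mu> n) = ennreal (exp (real n * \<Lambda> \<xi>))"
begin

lemma halfspace_bound:
  assumes n: "n \<ge> 1" and \<xi>: "\<xi> \<in> D"
  shows "emeasure (\<mu> n) {x. q < \<xi> \<bullet> x - \<Lambda> \<xi>} \<le> ennreal (exp (- (real n * q)))"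
proof -
  note sets_eq[OF n, measurable_cong]
  have "emeasure (\<mu> n) {x. q < \<xi> \<bullet> x - \<Lambda> \<xi>} = (\<integral>\<^sup>+ x. indicator {x. q < \<xi> \<bullet> x - \<Lambda> \<xi>} x \<partial>\<mu> n)"
    by (subst nn_integral_indicator) (auto simp: sets_eq[OF n])
  also have "\<dots> \<le> (\<integral>\<^sup>+ x. ennreal (exp (- (real n * (q + \<Lambda> \<xi>)))) * ennreal (exp (real n * (\<xi> \<bullet> x))) \<partial>\<mu> n)"
  proof (rule nn_integral_mono)
    fix x
    show "indicator {x. q < \<xi> \<bullet> x - \<Lambda> \<xi>} x \<le>
      ennreal (exp (- (real n * (q + \<Lambda> \<xi>)))) * ennreal (exp (real n * (\<xi> \<bullet> x)))"
    proof (cases "q < \<xi> \<bullet> x - \<Lambda> \<xi>")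
      case True
      then have "0 \<le> real n * (\<xi> \<bullet> x - \<Lambda> \<xi> - q)" by simp
      then have "0 \<le> - (real n * (q + \<Lambda> \<xi>)) + real n * (\<xi> \<bullet> x)"
        by (simp only: algebra_simps)
      then have "1 \<le> exp (- (real n * (q + \<Lambda> \<xi>)) + real n * (\<xi> \<bullet> x))"
        by (simp only: one_le_exp_iff)
      then show ?thesis
        using True by (simp add: ennreal_mult[symmetric] exp_add[symmetric] del: one_le_exp_iff)
    qed simp
  qed
  also have "\<dots> = ennreal (exp (- (real n * (q + \<Lambda> \<xi>)))) * ennreal (exp (real n * \<Lambda> \<xi>))"
    by (subst nn_integral_cmult) (auto simp: moment[OF n \<xi>])
  also have "\<dots> = ennreal (exp (- (real n * q)))"
    by (simp add: ennreal_mult[symmetric] exp_add[symmetric] algebra_simps)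
  finally show ?thesis .
qed

text \<open>Exponential tightness: the \<open>2 * DIM('a)\<close> half-spaces with normals along the
positive and negative coordinate axes already cover the complement of a ball.\<close>

lemma exterior_halfspaces:
  obtains A :: "'a set" and R where "finite A" "A \<subseteq> D"
    "\<And>x. R < norm x \<Longrightarrow> \<exists>\<xi>\<in>A. \<eta> < \<xi> \<bullet> x - \<Lambda> \<xi>"
proof -
  obtain r where r: "r > 0" "cball 0 r \<subseteq> D"
    using zero_interior by (auto simp: mem_interior_cball)
  define A :: "'a set" where "A = (\<lambda>b. r *\<^sub>R b) ` Basis \<union> (\<lambda>b. - r *\<^sub>R b) ` Basis"
  define R where "R = (\<Sum>b\<in>Basis. (\<bar>\<eta>\<bar> + \<bar>\<Lambda> (r *\<^sub>R b)\<bar> + \<bar>\<Lambda> (- r *\<^sub>R b)\<bar>) / r)"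
  have "finite A" "A \<subseteq> D"
    using r by (auto simp: A_def intro!: subsetD[OF r(2)])
  moreover have "\<exists>\<xi>\<in>A. \<eta> < \<xi> \<bullet> x - \<Lambda> \<xi>" if "R < norm x" for x
  proof (rule ccontr)
    assume "\<not> ?thesis"
    then have le: "\<xi> \<bullet> x \<le> \<eta> + \<Lambda> \<xi>" if "\<xi> \<in> A" for \<xi>
      using that by force
    have "norm x \<le> (\<Sum>b\<in>Basis. \<bar>x \<bullet> b\<bar>)" by (rule norm_le_l1)
    also have "\<dots> \<le> R"
      unfolding R_def
    proof (rule sum_mono)
      fix b :: 'a assume b: "b \<in> Basis"
      have "r * (b \<bullet> x) \<le> \<eta> + \<Lambda> (r *\<^sub>R b)" "- (r * (b \<bullet> x)) \<le> \<eta> + \<Lambda> (- r *\<^sub>R b)"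
        using le[of "r *\<^sub>R b"] le[of "- r *\<^sub>R b"] b by (auto simp: A_def)
      then have "r * \<bar>x \<bullet> b\<bar> \<le> \<bar>\<eta>\<bar> + \<bar>\<Lambda> (r *\<^sub>R b)\<bar> + \<bar>\<Lambda> (- r *\<^sub>R b)\<bar>"
        by (cases "x \<bullet> b \<ge> 0") (auto simp: inner_commute)
      then show "\<bar>x \<bullet> b\<bar> \<le> (\<bar>\<eta>\<bar> + \<bar>\<Lambda> (r *\<^sub>R b)\<bar> + \<bar>\<Lambda> (- r *\<^sub>R b)\<bar>) / r"
        using r by (simp add: field_simps)
    qed
    finally show False using that by simp
  qed
  ultimately show ?thesis using that by blast
qed

text \<open>Every point of \<open>F\<close> lies in an open half-space of exponentially small mass.
Compactness leaves finitely many of them inside a ball, and \<open>exterior_halfspaces\<close>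
handles the rest. Since only finitely many are needed, the decay rate \<open>\<eta>'\<close> is
strictly larger than \<open>\<eta>\<close>; for \<open>\<eta> = 0\<close> this gives exponential
decay, which is how the lower bound uses the lemma.\<close>

lemma closed_bound:
  assumes F: "closed F" and above: "\<And>t. t \<in> F \<Longrightarrow> \<exists>\<xi>\<in>D. \<eta> < \<xi> \<bullet> t - \<Lambda> \<xi>"
  shows "\<exists>C>0. \<exists>\<eta>'>\<eta>. \<forall>n\<ge>1. emeasure (\<mu> n) F \<le> ennreal (C * exp (- (real n * \<eta>')))"
proof -
  obtain A R where A: "finite A" "A \<subseteq> D"
    and ext: "\<And>x. R < norm x \<Longrightarrow> \<exists>\<xi>\<in>A. \<eta> + 1 < \<xi> \<bullet> x - \<Lambda> \<xi>"
    by (rule exterior_halfspaces[of "\<eta> + 1"]) blast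
  \<comment> \<open>The threshold \<open>q\<close> varies with the half-space, so that a finite cover leaves a gap above \<open>\<eta>\<close>.\<close>
  define H where "H = (\<lambda>(\<xi>, q). {x. q < \<xi> \<bullet> x - \<Lambda> \<xi>})"
  have opH: "open (H c)" for c
    unfolding H_def by (auto simp: split_beta intro!: open_Collect_less continuous_intros)
  have "compact (F \<inter> cball 0 R)"
    using F by (simp add: closed_Int_compact)
  moreover have "F \<inter> cball 0 R \<subseteq> (\<Union>c\<in>D \<times> {\<eta><..}. H c)"
  proof
    fix t assume "t \<in> F \<inter> cball 0 R"
    with above obtain \<xi> where "\<xi> \<in> D" "\<eta> < \<xi> \<bullet> t - \<Lambda> \<xi>" by blast
    moreover obtain q where "\<eta> < q" "q < \<xi> \<bullet> t - \<Lambda> \<xi>"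
      using dense[OF \<open>\<eta> < \<xi> \<bullet> t - \<Lambda> \<xi>\<close>] by blast
    ultimately show "t \<in> (\<Union>c\<in>D \<times> {\<eta><..}. H c)" by (auto simp: H_def)
  qed
  ultimately obtain C where C: "C \<subseteq> D \<times> {\<eta><..}" "finite C" "F \<inter> cball 0 R \<subseteq> (\<Union>c\<in>C. H c)"
    using opH by (metis compactE_image)
  define C' where "C' = C \<union> A \<times> {\<eta> + 1}"
  have C': "finite C'" "C' \<subseteq> D \<times> {\<eta><..}"
    using A C by (auto simp: C'_def)
  have cover: "F \<subseteq> (\<Union>c\<in>C'. H c)"
  proof
    fix x assume "x \<in> F"
    show "x \<in> (\<Union>c\<in>C'. H c)"
    proof (cases "norm x \<le> R")
      case True
      then show ?thesis using C(3) \<open>x \<in> F\<close> by (auto simp: C'_def)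
    next
      case False
      then obtain \<xi> where "\<xi> \<in> A" "\<eta> + 1 < \<xi> \<bullet> x - \<Lambda> \<xi>" using ext by force
      then have "(\<xi>, \<eta> + 1) \<in> C'" "x \<in> H (\<xi>, \<eta> + 1)" by (auto simp: C'_def H_def)
      then show ?thesis by blast
    qed
  qed
  define \<eta>' where "\<eta>' = Min (insert (\<eta> + 1) (snd ` C'))"
  have \<eta>': "\<eta> < \<eta>'" "\<And>c. c \<in> C' \<Longrightarrow> \<eta>' \<le> snd c"
    using C' by (auto simp: \<eta>'_def Min_gr_iff)
  \<comment> \<open>The summand 1 keeps the constant positive when \<open>C'\<close> is empty.\<close>
  have "emeasure (\<mu> n) F \<le> ennreal ((real (card C') + 1) * exp (- (real n * \<eta>')))" if n: "n \<ge> 1" for n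
  proof -
    have "emeasure (\<mu> n) F \<le> emeasure (\<mu> n) (\<Union>c\<in>C'. H c)"
      using cover opH by (intro emeasure_mono) (auto simp: sets_eq[OF n] intro!: borel_open)
    also have "\<dots> \<le> (\<Sum>c\<in>C'. emeasure (\<mu> n) (H c))"
      using C' opH by (intro emeasure_subadditive_finite) (auto simp: sets_eq[OF n])
    also have "\<dots> \<le> (\<Sum>c\<in>C'. ennreal (exp (- (real n * \<eta>'))))"
    proof (rule sum_mono)
      fix c assume c: "c \<in> C'"
      have "emeasure (\<mu> n) (H c) \<le> ennreal (exp (- (real n * snd c)))"
        using halfspace_bound[OF n, of "fst c" "snd c"] c C' by (auto simp: H_def split_beta)
      also have "\<dots> \<le> ennreal (exp (- (real n * \<eta>')))"
        using \<eta>'(2)[OF c] by (intro ennreal_leI) (simp add: mult_left_mono)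
      finally show "emeasure (\<mu> n) (H c) \<le> ennreal (exp (- (real n * \<eta>')))" .
    qed
    also have "\<dots> = ennreal (real (card C') * exp (- (real n * \<eta>')))"
      by (simp add: ennreal_mult' ennreal_of_nat_eq_real_of_nat)
    also have "\<dots> \<le> ennreal ((real (card C') + 1) * exp (- (real n * \<eta>')))"
      by (intro ennreal_leI mult_right_mono) auto
    finally show ?thesis .
  qed
  then show ?thesis
    using \<eta>'(1) by (intro exI[of _ "real (card C') + 1"]) auto
qed

end

text \<open>If \<open>s\<close> is not the gradient \<open>t\<close> of \<open>f\<close> at
\<open>\<xi>\<close>, then to first order a small step in the direction \<open>s - t\<close>
increases \<open>\<zeta> \<bullet> s - f (\<xi> + \<zeta>)\<close>.\<close>

lemma GDERIV_above_tangent: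
  fixes f :: "'a::euclidean_space \<Rightarrow> real"
  assumes der: "GDERIV f \<xi> :> t" and "s \<noteq> t" and \<xi>: "\<xi> \<in> interior D"
  shows "\<exists>\<zeta>. \<xi> + \<zeta> \<in> D \<and> 0 < \<zeta> \<bullet> s - (f (\<xi> + \<zeta>) - f \<xi>)"
proof -
  define u where "u = s - t"
  have u: "u \<bullet> u > 0" using \<open>s \<noteq> t\<close> by (simp add: u_def)
  have "(f has_derivative (\<lambda>h. h \<bullet> t)) (at (\<xi> + 0 *\<^sub>R u))"
    using der by (simp add: gderiv_def)
  then have "((\<lambda>h. f (\<xi> + h *\<^sub>R u)) has_derivative (\<lambda>h. (h *\<^sub>R u) \<bullet> t)) (at (0::real))"
    by (rule has_derivative_compose[rotated]) (auto intro!: derivative_eq_intros)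
  then have "((\<lambda>h. f (\<xi> + h *\<^sub>R u)) has_real_derivative (u \<bullet> t)) (at 0)"
    by (simp add: has_field_derivative_def mult_commute_abs)
  then have "((\<lambda>h. h * (u \<bullet> s) - f (\<xi> + h *\<^sub>R u)) has_real_derivative (u \<bullet> s - u \<bullet> t)) (at 0)"
    by (auto intro!: derivative_eq_intros)
  moreover have "u \<bullet> s - u \<bullet> t = u \<bullet> u" by (simp add: u_def inner_diff_right)
  ultimately obtain d where d: "d > 0"
    "\<And>h. 0 < h \<Longrightarrow> h < d \<Longrightarrow> - f \<xi> < h * (u \<bullet> s) - f (\<xi> + h *\<^sub>R u)"
    using DERIV_pos_inc_right[of "\<lambda>h. h * (u \<bullet> s) - f (\<xi> + h *\<^sub>R u)" "u \<bullet> u" 0] u by auto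
  obtain r where r: "r > 0" "cball \<xi> r \<subseteq> D" using \<xi> by (auto simp: mem_interior_cball)
  define h where "h = min (d / 2) (r / norm u)"
  have h: "0 < h" "h < d" "h * norm u \<le> r"
    using d r u by (auto simp: h_def min_def field_simps)
  have "\<xi> + h *\<^sub>R u \<in> cball \<xi> r" using h by (simp add: dist_norm)
  then show ?thesis using d(2)[OF h(1,2)] r by (intro exI[of _ "h *\<^sub>R u"]) auto
qed

context exponential_moments
begin

lemma tilted_exponential_moments:
  assumes \<xi>: "\<xi> \<in> interior D"
  shows "exponential_moments
     (\<lambda>n. density (\<mu> n) (\<lambda>x. ennreal (exp (real n * (\<xi> \<bullet> x - \<Lambda> \<xi>)))))
     {\<zeta>. \<xi> + \<zeta> \<in> D} (\<lambda>\<zeta>. \<Lambda> (\<xi> + \<zeta>) - \<Lambda> \<xi>)"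
proof -
  have \<xi>D: "\<xi> \<in> D" using \<xi> interior_subset by blast
  have tilt: "(\<integral>\<^sup>+ x. ennreal (exp (real n * (\<zeta> \<bullet> x)))
        \<partial>density (\<mu> n) (\<lambda>x. ennreal (exp (real n * (\<xi> \<bullet> x - \<Lambda> \<xi>)))))
      = ennreal (exp (real n * (\<Lambda> (\<xi> + \<zeta>) - \<Lambda> \<xi>)))"
    if n: "n \<ge> 1" and \<zeta>: "\<xi> + \<zeta> \<in> D" for n \<zeta>
  proof -
    note sets_eq[OF n, measurable_cong]
    have "(\<integral>\<^sup>+ x. ennreal (exp (real n * (\<zeta> \<bullet> x)))
        \<partial>density (\<mu> n) (\<lambda>x. ennreal (exp (real n * (\<xi> \<bullet> x - \<Lambda> \<xi>)))))
      = (\<integral>\<^sup>+ x. ennreal (exp (real n * (\<xi> \<bullet> x - \<Lambda> \<xi>))) * ennreal (exp (real n * (\<zeta> \<bullet> x))) \<partial>\<mu> n)"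
      by (subst nn_integral_density) auto
    also have "\<dots> = (\<integral>\<^sup>+ x. ennreal (exp (- (real n * \<Lambda> \<xi>))) * ennreal (exp (real n * ((\<xi> + \<zeta>) \<bullet> x))) \<partial>\<mu> n)"
      by (intro nn_integral_cong)
         (simp add: ennreal_mult[symmetric] exp_add[symmetric] algebra_simps)
    also have "\<dots> = ennreal (exp (- (real n * \<Lambda> \<xi>))) * ennreal (exp (real n * \<Lambda> (\<xi> + \<zeta>)))"
      by (subst nn_integral_cmult) (auto simp: moment[OF n \<zeta>])
    finally show ?thesis
      by (simp add: ennreal_mult[symmetric] exp_add[symmetric] algebra_simps)
  qed
  show ?thesis
  proof (rule exponential_moments.intro)
    fix n :: nat assume n: "n \<ge> 1"
    note sets_eq[OF n, measurable_cong]
    have "emeasure (density (\<mu> n) (\<lambda>x. ennreal (exp (real n * (\<xi> \<bullet> x - \<Lambda> \<xi>)))))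
          (space (density (\<mu> n) (\<lambda>x. ennreal (exp (real n * (\<xi> \<bullet> x - \<Lambda> \<xi>)))))) = 1"
      using tilt[OF n, of 0] \<xi>D by simp
    then show "prob_space (density (\<mu> n) (\<lambda>x. ennreal (exp (real n * (\<xi> \<bullet> x - \<Lambda> \<xi>)))))"
      by (rule prob_spaceI)
    show "sets (density (\<mu> n) (\<lambda>x. ennreal (exp (real n * (\<xi> \<bullet> x - \<Lambda> \<xi>))))) = sets borel"
      by (simp add: sets_eq[OF n])
  next
    obtain r where "r > 0" "ball \<xi> r \<subseteq> D" using \<xi> by (auto simp: mem_interior)
    then have "ball 0 r \<subseteq> {\<zeta>. \<xi> + \<zeta> \<in> D}" by (auto simp: dist_norm)
    then show "0 \<in> interior {\<zeta>. \<xi> + \<zeta> \<in> D}" using \<open>r > 0\<close> by (auto simp: mem_interior)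
  qed (use tilt in auto)
qed

text \<open>Under the tilted laws the point \<open>t\<close> is the typical value: the upper bound
for them, with \<open>\<eta> = 0\<close>, makes the complement of any neighbourhood of
\<open>t\<close> exponentially unlikely. Where
\<open>\<xi> \<bullet> x < \<xi> \<bullet> t + \<epsilon>\<close>, the tilting density is at most
\<open>exp (n * (\<xi> \<bullet> t - \<Lambda> \<xi> + \<epsilon>))\<close>, so undoing the tilt
costs no more than this factor.\<close>

lemma open_bound:
  assumes G: "open G" "t \<in> G" and \<xi>: "\<xi> \<in> interior D" and der: "GDERIV \<Lambda> \<xi> :> t"
    and \<epsilon>: "\<epsilon> > 0"
  shows "\<forall>\<^sub>F n in sequentially.
    ennreal (exp (- (real n * (\<xi> \<bullet> t - \<Lambda> \<xi> + \<epsilon>))) / 2) \<le> emeasure (\<mu> n) G"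
proof -
  define f where "f = (\<lambda>n x. ennreal (exp (real n * (\<xi> \<bullet> x - \<Lambda> \<xi>))))"
  define Q where "Q = G \<inter> {x. \<xi> \<bullet> x < \<xi> \<bullet> t + \<epsilon>}"
  have Q: "open Q" "t \<in> Q" using G \<epsilon>
    by (auto simp: Q_def intro!: open_Int open_Collect_less continuous_intros)
  interpret tilt: exponential_moments "\<lambda>n. density (\<mu> n) (f n)" "{\<zeta>. \<xi> + \<zeta> \<in> D}" "\<lambda>\<zeta>. \<Lambda> (\<xi> + \<zeta>) - \<Lambda> \<xi>"
    unfolding f_def by (rule tilted_exponential_moments[OF \<xi>])
  have "\<exists>C>0. \<exists>\<eta>'>0. \<forall>n\<ge>1. emeasure (density (\<mu> n) (f n)) (- Q) \<le> ennreal (C * exp (- (real n * \<eta>')))"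
  proof (rule tilt.closed_bound)
    show "closed (- Q)" using Q by (simp add: open_closed)
    fix s assume "s \<in> - Q"
    then have "s \<noteq> t" using Q by auto
    then show "\<exists>\<zeta>\<in>{\<zeta>. \<xi> + \<zeta> \<in> D}. 0 < \<zeta> \<bullet> s - (\<Lambda> (\<xi> + \<zeta>) - \<Lambda> \<xi>)"
      using GDERIV_above_tangent[OF der _ \<xi>, of s] by blast
  qed
  then obtain C \<eta>' where C: "C > 0" "\<eta>' > 0"
    "\<And>n. n \<ge> 1 \<Longrightarrow> emeasure (density (\<mu> n) (f n)) (- Q) \<le> ennreal (C * exp (- (real n * \<eta>')))"
    by blast
  have "(\<lambda>n. C * exp (- \<eta>') ^ n) \<longlonglongrightarrow> C * 0"
    using C by (intro tendsto_mult LIMSEQ_power_zero tendsto_const) auto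
  then have "\<forall>\<^sub>F n in sequentially. C * exp (- \<eta>') ^ n < 1 / 2"
    by (rule order_tendstoD) simp
  then have "\<forall>\<^sub>F n in sequentially. C * exp (- (real n * \<eta>')) < 1 / 2"
    by (simp add: exp_of_nat_mult[symmetric])
  then show ?thesis
    using eventually_ge_at_top[of 1]
  proof eventually_elim
    case (elim n)
    then have n: "n \<ge> 1" by simp
    note sets_eq[OF n, measurable_cong]
    define c where "c = exp (real n * (\<xi> \<bullet> t - \<Lambda> \<xi> + \<epsilon>))"
    interpret prob_space "density (\<mu> n) (f n)" by (rule tilt.prob[OF n])
    have sp: "space (\<mu> n) = UNIV" using sets_eq_imp_space_eq[OF sets_eq[OF n]] by simp
    have Qs: "Q \<in> events" using Q by (simp add: sets_eq[OF n])
    have "ennreal (measure (density (\<mu> n) (f n)) (- Q)) \<le> ennreal (1 / 2)"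
      unfolding emeasure_eq_measure[symmetric]
      by (rule order_trans[OF C(3)[OF n] ennreal_leI]) (use elim in simp)
    then have "prob (- Q) \<le> 1 / 2" by (subst (asm) ennreal_le_iff) auto
    then have "1 / 2 \<le> prob Q"
      using prob_compl[OF Qs] by (simp add: Compl_eq_Diff_UNIV sp)
    then have "ennreal (1 / 2) \<le> emeasure (density (\<mu> n) (f n)) Q"
      unfolding emeasure_eq_measure by (rule ennreal_leI)
    also have "\<dots> = (\<integral>\<^sup>+ x. f n x * indicator Q x \<partial>\<mu> n)"
      using Qs by (intro emeasure_density) (auto simp: f_def sets_eq[OF n])
    also have "\<dots> \<le> (\<integral>\<^sup>+ x. ennreal c * indicator Q x \<partial>\<mu> n)"
    proof (rule nn_integral_mono)
      fix x
      show "f n x * indicator Q x \<le> ennreal c * indicator Q x"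
        by (auto simp: f_def c_def Q_def indicator_def intro!: mult_left_mono)
    qed
    also have "\<dots> = ennreal c * emeasure (\<mu> n) Q"
      using Qs by (subst nn_integral_cmult_indicator) auto
    also have "\<dots> \<le> ennreal c * emeasure (\<mu> n) G"
      using G by (intro mult_left_mono emeasure_mono) (auto simp: Q_def sets_eq[OF n])
    finally have "ennreal (1 / 2) \<le> ennreal c * emeasure (\<mu> n) G" .
    then have "ennreal (1 / c) * ennreal (1 / 2) \<le> ennreal (1 / c) * (ennreal c * emeasure (\<mu> n) G)"
      by (intro mult_left_mono) auto
    also have "\<dots> = emeasure (\<mu> n) G"
      by (simp add: mult.assoc[symmetric] ennreal_mult[symmetric] c_def)
    finally have "ennreal (1 / c) * ennreal (1 / 2) \<le> emeasure (\<mu> n) G" .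
    moreover have "ennreal (1 / c) * ennreal (1 / 2) = ennreal (1 / c * (1 / 2))"
      by (rule ennreal_mult[symmetric]) (auto simp: c_def)
    ultimately show ?case
      by (simp add: c_def exp_minus inverse_eq_divide)
  qed
qed

end

section \<open>Large deviations of continuous images\<close>

lemma ln_ereal_le:
  assumes "x \<le> ennreal c" "0 < c"
  shows "ln_ereal x \<le> ereal (ln c)"
proof (cases "x = 0")
  case False
  have fin: "x \<noteq> \<infinity>" using assms by (auto simp: top_unique)
  then have "0 < enn2real x" using False
    by (simp add: enn2real_positive_iff zero_less_iff_neq_zero top.not_eq_extremum)
  moreover have "enn2real x \<le> c" using assms by (intro enn2real_leI) auto
  ultimately show ?thesis using False fin by (simp add: ln_ereal_def)
qed (simp add: ln_ereal_def)

lemma le_ln_ereal: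
  assumes "ennreal c \<le> x" "0 < c"
  shows "ereal (ln c) \<le> ln_ereal x"
proof (cases "x = \<infinity>")
  case False
  have "x \<noteq> 0" using assms by (auto simp: ennreal_eq_0_iff)
  moreover have "c \<le> enn2real x" using assms False
    by (metis enn2real_ennreal enn2real_mono infinity_ennreal_def less_imp_le top.not_eq_extremum)
  ultimately show ?thesis using False assms by (simp add: ln_ereal_def)
qed (simp add: ln_ereal_def)

lemma exponential_rate_tendsto: "(\<lambda>n. ereal (ln C / real n - \<eta>)) \<longlonglongrightarrow> ereal (- \<eta>)"
proof -
  have "(\<lambda>n. ln C / real n - \<eta>) \<longlonglongrightarrow> 0 - \<eta>"
    by (intro tendsto_diff lim_const_over_n tendsto_const)
  then show ?thesis by simp
qed

lemma limsup_ln_ereal_le: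
  assumes C: "C > 0" and bound: "\<forall>\<^sub>F n in sequentially. p n \<le> ennreal (C * exp (- (real n * \<eta>)))"
  shows "limsup (\<lambda>n. ln_ereal (p n) / ereal (real n)) \<le> ereal (- \<eta>)"
proof -
  have "limsup (\<lambda>n. ln_ereal (p n) / ereal (real n)) \<le> limsup (\<lambda>n. ereal (ln C / real n - \<eta>))"
  proof (rule Limsup_mono)
    show "\<forall>\<^sub>F n in sequentially. ln_ereal (p n) / ereal (real n) \<le> ereal (ln C / real n - \<eta>)"
      using bound eventually_gt_at_top[of 0]
    proof eventually_elim
      case (elim n)
      have "ln_ereal (p n) \<le> ereal (ln (C * exp (- (real n * \<eta>))))"
        using elim C by (intro ln_ereal_le) auto
      then have "ln_ereal (p n) / ereal (real n) \<le> ereal (ln (C * exp (- (real n * \<eta>)))) / ereal (real n)"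
        using elim by (intro ereal_divide_right_mono) auto
      also have "\<dots> = ereal (ln C / real n - \<eta>)"
        using elim C by (simp add: ln_mult field_simps)
      finally show ?case .
    qed
  qed
  also have "\<dots> = ereal (- \<eta>)"
    by (intro lim_imp_Limsup exponential_rate_tendsto) simp
  finally show ?thesis .
qed

lemma liminf_ln_ereal_ge:
  assumes C: "C > 0" and bound: "\<forall>\<^sub>F n in sequentially. ennreal (C * exp (- (real n * \<eta>))) \<le> p n"
  shows "ereal (- \<eta>) \<le> liminf (\<lambda>n. ln_ereal (p n) / ereal (real n))"
proof -
  have "ereal (- \<eta>) = liminf (\<lambda>n. ereal (ln C / real n - \<eta>))"
    by (intro lim_imp_Liminf[symmetric] exponential_rate_tendsto) simp
  also have "\<dots> \<le> liminf (\<lambda>n. ln_ereal (p n) / ereal (real n))"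
  proof (rule Liminf_mono)
    show "\<forall>\<^sub>F n in sequentially. ereal (ln C / real n - \<eta>) \<le> ln_ereal (p n) / ereal (real n)"
      using bound eventually_gt_at_top[of 0]
    proof eventually_elim
      case (elim n)
      have "ereal (ln C / real n - \<eta>) = ereal (ln (C * exp (- (real n * \<eta>)))) / ereal (real n)"
        using elim C by (simp add: ln_mult field_simps)
      also have "\<dots> \<le> ln_ereal (p n) / ereal (real n)"
        using elim C by (intro ereal_divide_right_mono le_ln_ereal) auto
      finally show ?case .
    qed
  qed
  finally show ?thesis .
qed

text \<open>The Borel sets of a subspace are the traces of Borel sets; this identifies the events in the
definition of a large deviation principle.\<close>

lemma sigma_sets_top_of_set:
  fixes Y :: "'a::topological_space set"
  shows "sigma_sets (topspace (top_of_set Y)) {U. openin (top_of_set Y) U} = sets (restrict_space borel Y)"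
proof -
  have "sets (restrict_space borel Y) = {id -` A \<inter> Y |A. A \<in> sigma_sets UNIV {S::'a set. open S}}"
    by (auto simp: sets_restrict_space borel_def)
  also have "\<dots> = sigma_sets Y {id -` A \<inter> Y |A. A \<in> {S. open S}}"
    by (rule sigma_sets_vimage_commute) auto
  also have "{id -` A \<inter> Y |A. A \<in> {S. open S}} = {U. openin (top_of_set Y) U}"
    by (auto simp: openin_open)
  finally show ?thesis by simp
qed

context exponential_moments
begin

definition rate :: "'a \<Rightarrow> ereal" where "rate t = (SUP \<xi>\<in>D. ereal (\<xi> \<bullet> t - \<Lambda> \<xi>))"

lemma zero_in_D: "0 \<in> D"
  using zero_interior interior_subset by blast

lemma rate_nonneg: "0 \<le> rate t"
proof -
  interpret prob_space "\<mu> 1" by (rule prob) simp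
  have "ennreal (exp (\<Lambda> 0)) = 1" using moment[of 1 0] zero_in_D emeasure_space_1 by simp
  then have "\<Lambda> 0 = 0" by simp
  then have "0 = ereal (0 \<bullet> t - \<Lambda> 0)" by simp
  also have "\<dots> \<le> rate t" unfolding rate_def by (rule SUP_upper[OF zero_in_D])
  finally show ?thesis .
qed

lemma less_rate_iff: "ereal \<eta> < rate t \<longleftrightarrow> (\<exists>\<xi>\<in>D. \<eta> < \<xi> \<bullet> t - \<Lambda> \<xi>)"
  by (simp add: rate_def less_SUP_iff)

lemma compact_rate_sublevel: "compact {t. rate t \<le> ereal \<eta>}"
  unfolding compact_eq_bounded_closed
proof
  obtain A R where A: "A \<subseteq> D" "\<And>x. R < norm x \<Longrightarrow> \<exists>\<xi>\<in>A. \<eta> < \<xi> \<bullet> x - \<Lambda> \<xi>"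
    by (rule exterior_halfspaces[of \<eta>]) blast
  have "norm t \<le> R" if "rate t \<le> ereal \<eta>" for t
    using that A less_rate_iff[of \<eta> t] by (meson not_le subsetD)
  then show "bounded {t. rate t \<le> ereal \<eta>}" by (auto simp: bounded_iff)
  have "{t. rate t \<le> ereal \<eta>} = (\<Inter>\<xi>\<in>D. {t. \<xi> \<bullet> t - \<Lambda> \<xi> \<le> \<eta>})"
    by (auto simp: rate_def SUP_le_iff)
  then show "closed {t. rate t \<le> ereal \<eta>}"
    by (auto intro!: closed_INT closed_Collect_le continuous_intros)
qed

text \<open>Cramer's theorem and the contraction principle in one statement. That the rate is
infinite outside \<open>U\<close> serves twice: the compact sub-level sets lie in \<open>U\<close>,
and a relatively closed subset of \<open>U\<close> can be replaced by a closed subset of the whole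
space in the upper bound. The hypothesis \<open>exposed\<close> provides, for each point of
\<open>U\<close>, the tilt for the lower bound.\<close>

theorem large_deviations_continuous_image:
  fixes \<phi> :: "'a \<Rightarrow> 'b::t2_space"
  assumes U: "open U" and null: "\<And>n. n \<ge> 1 \<Longrightarrow> emeasure (\<mu> n) (- U) = 0"
    and outside: "\<And>t. t \<notin> U \<Longrightarrow> rate t = \<infinity>"
    and exposed: "\<And>t. t \<in> U \<Longrightarrow> \<exists>\<xi>\<in>interior D. GDERIV \<Lambda> \<xi> :> t \<and> rate t = ereal (\<xi> \<bullet> t - \<Lambda> \<xi>)"
    and cont: "continuous_on U \<phi>" and maps: "\<phi> \<in> U \<rightarrow> Y"
  shows "large_deviation_principle (top_of_set Y)
    (\<lambda>n. distr (restrict_space (\<mu> n) U) (restrict_space borel Y) \<phi>)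
    (\<lambda>y. INF t\<in>{t\<in>U. \<phi> t = y}. rate t)"
proof -
  define I where "I y = (INF t\<in>{t\<in>U. \<phi> t = y}. rate t)" for y
  define \<nu> where "\<nu> n = distr (restrict_space (\<mu> n) U) (restrict_space borel Y) \<phi>" for n
  define K where "K \<eta> = {t. rate t \<le> ereal \<eta>}" for \<eta>
  have K_sub: "K \<eta> \<subseteq> U" for \<eta>
    using outside by (force simp: K_def)
  have K_compact: "compact (K \<eta>)" for \<eta>
    unfolding K_def by (rule compact_rate_sublevel)
  have I_nonneg: "0 \<le> I y" for y
    unfolding I_def by (intro INF_greatest rate_nonneg)
  have I_le: "I (\<phi> t) \<le> rate t" if "t \<in> U" for t
    unfolding I_def using that by (intro INF_lower) auto
  have sublevel: "{y \<in> Y. I y \<le> ereal \<eta>} = \<phi> ` K \<eta>" for \<eta>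
  proof (intro equalityI subsetI)
    fix y assume "y \<in> \<phi> ` K \<eta>"
    then obtain t where t: "t \<in> K \<eta>" "y = \<phi> t" by blast
    then have "t \<in> U" using K_sub by blast
    then show "y \<in> {y \<in> Y. I y \<le> ereal \<eta>}"
      using t maps order_trans[OF I_le, of t] by (auto simp: K_def)
  next
    fix y assume y: "y \<in> {y \<in> Y. I y \<le> ereal \<eta>}"
    \<comment> \<open>The infimum over a fibre is attained: the fibre meets each larger sub-level set in a nonempty
      compact set, and these sets are nested.\<close>
    define F where "F n = {t \<in> K (\<eta> + inverse (real (Suc n))). \<phi> t = y}" for n
    have "compact (F n) \<and> F n \<noteq> {}" for n
    proof
      have "closed (F n)"
        unfolding F_def
        by (rule continuous_closed_preimage_constant[OF continuous_on_subset[OF cont K_sub]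
              compact_imp_closed[OF K_compact]])
      moreover have "F n = K (\<eta> + inverse (real (Suc n))) \<inter> F n" by (auto simp: F_def)
      ultimately show "compact (F n)" using K_compact by (metis compact_Int_closed)
      have "I y < ereal (\<eta> + inverse (real (Suc n)))"
        using y by (intro le_less_trans[of "I y" "ereal \<eta>"]) auto
      then obtain t where "t \<in> U" "\<phi> t = y" "rate t < ereal (\<eta> + inverse (real (Suc n)))"
        unfolding I_def INF_less_iff by blast
      then show "F n \<noteq> {}" by (auto simp: F_def K_def intro!: exI[of _ t])
    qed
    moreover have "F n \<subseteq> F m" if "m \<le> n" for m n
    proof -
      have "inverse (real (Suc n)) \<le> inverse (real (Suc m))"
        using that by (intro le_imp_inverse_le) auto
      then show ?thesis
        by (auto simp: F_def K_def elim!: order_trans)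
    qed
    ultimately have "\<Inter>(range F) \<noteq> {}" by (intro compact_nest) auto
    then obtain t where t: "\<And>n. t \<in> F n" by auto
    have "rate t \<le> ereal \<eta>"
    proof (rule LIMSEQ_le_const)
      show "(\<lambda>n. ereal (\<eta> + inverse (real (Suc n)))) \<longlonglongrightarrow> ereal \<eta>"
        using tendsto_add[OF tendsto_const LIMSEQ_inverse_real_of_nat, of \<eta>] by simp
      show "\<exists>N. \<forall>n\<ge>N. rate t \<le> ereal (\<eta> + inverse (real (Suc n)))"
        using t by (auto simp: F_def K_def)
    qed
    moreover have "\<phi> t = y" using t[of 0] by (simp add: F_def)
    ultimately show "y \<in> \<phi> ` K \<eta>" by (auto simp: K_def)
  qed
  have image_compact: "compact (\<phi> ` K \<eta>)" for \<eta>
    using cont K_sub by (intro compact_continuous_image K_compact) (rule continuous_on_subset)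
  have rate_fun: "rate_function (top_of_set Y) I"
    unfolding rate_function_def
  proof (intro conjI ballI allI impI)
    fix c :: ereal
    show "openin (top_of_set Y) {y \<in> topspace (top_of_set Y). c < I y}"
    proof (cases c)
      case (real \<eta>)
      have "{y \<in> topspace (top_of_set Y). c < I y} = Y - \<phi> ` K \<eta>"
        unfolding sublevel[symmetric] real by auto
      also have "\<dots> = Y \<inter> - \<phi> ` K \<eta>" by blast
      finally show ?thesis
        using compact_imp_closed[OF image_compact, of \<eta>] by (auto intro!: openin_open_Int)
    next
      case MInf
      have "{y \<in> topspace (top_of_set Y). c < I y} = topspace (top_of_set Y)"
        using I_nonneg by (auto simp: MInf intro: less_le_trans[of _ 0])
      then show ?thesis by (metis openin_topspace)
    qed simp
  next
    fix \<eta> :: real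
    have "{y \<in> topspace (top_of_set Y). I y \<le> ereal \<eta>} = \<phi> ` K \<eta>" using sublevel by simp
    then show "compactin (top_of_set Y) {y \<in> topspace (top_of_set Y). I y \<le> ereal \<eta>}"
      using image_compact sublevel[of \<eta>] by (auto simp: compactin_subtopology)
  qed (rule I_nonneg)
  have meas: "\<phi> \<in> measurable (restrict_space (\<mu> n) U) (restrict_space borel Y)" if n: "n \<ge> 1" for n
  proof (rule measurable_restrict_space2)
    show "\<phi> \<in> space (restrict_space (\<mu> n) U) \<rightarrow> Y"
      using maps by (auto simp: space_restrict_space)
    have "\<phi> \<in> borel_measurable (restrict_space borel U)"
      using cont by (rule borel_measurable_continuous_on_restrict)
    moreover have "sets (restrict_space borel U) = sets (restrict_space (\<mu> n) U)"
      by (simp add: sets_restrict_space sets_eq[OF n])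
    ultimately show "\<phi> \<in> borel_measurable (restrict_space (\<mu> n) U)"
      by (simp cong: measurable_cong_sets)
  qed
  have U_sets: "U \<in> sets (\<mu> n)" "space (\<mu> n) = UNIV" if "n \<ge> 1" for n
    using U sets_eq[OF that] sets_eq_imp_space_eq[OF sets_eq[OF that]] by auto
  have emeasure_\<nu>: "emeasure (\<nu> n) A = emeasure (\<mu> n) (\<phi> -` A \<inter> U)"
    "\<phi> -` A \<inter> U \<in> sets (\<mu> n)"
    if n: "n \<ge> 1" and A: "A \<in> sets (restrict_space borel Y)" for n A
  proof -
    have sp: "space (restrict_space (\<mu> n) U) = U"
      by (simp add: space_restrict_space U_sets[OF n])
    have "emeasure (\<nu> n) A = emeasure (restrict_space (\<mu> n) U) (\<phi> -` A \<inter> U)"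
      unfolding \<nu>_def using meas[OF n] A by (simp add: emeasure_distr sp)
    then show "emeasure (\<nu> n) A = emeasure (\<mu> n) (\<phi> -` A \<inter> U)"
      using U_sets[OF n] by (simp add: emeasure_restrict_space)
    have "\<phi> -` A \<inter> U \<in> sets (restrict_space (\<mu> n) U)"
      using measurable_sets[OF meas[OF n] A] by (simp add: sp)
    then show "\<phi> -` A \<inter> U \<in> sets (\<mu> n)"
      using U_sets[OF n] by (simp add: sets_restrict_space_iff)
  qed
  have prob_\<nu>: "prob_space (\<nu> n)" if n: "n \<ge> 1" for n
    unfolding \<nu>_def
  proof (rule prob_space.prob_space_distr[OF _ meas[OF n]])
    interpret prob_space "\<mu> n" by (rule prob[OF n])
    have "prob (- U) = 0" using null[OF n] by (simp add: measure_def)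
    then have "prob U = 1"
      using prob_compl[of U] U_sets[OF n] by (simp add: Compl_eq_Diff_UNIV)
    then show "prob_space (restrict_space (\<mu> n) U)"
      using U_sets[OF n] by (intro prob_space_restrict_space) (auto simp: emeasure_eq_measure)
  qed
  have bounds: "- (INF y \<in> top_of_set Y interior_of A. I y)
            \<le> liminf (\<lambda>n. ln_ereal (emeasure (\<nu> n) A) / ereal (real n))"
      "limsup (\<lambda>n. ln_ereal (emeasure (\<nu> n) A) / ereal (real n))
            \<le> - (INF y \<in> top_of_set Y closure_of A. I y)"
    if A: "A \<in> sets (restrict_space borel Y)" for A
  proof -
    let ?li = "liminf (\<lambda>n. ln_ereal (emeasure (\<nu> n) A) / ereal (real n))"
    let ?ls = "limsup (\<lambda>n. ln_ereal (emeasure (\<nu> n) A) / ereal (real n))"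
    define G where "G = \<phi> -` (top_of_set Y interior_of A) \<inter> U"
    have "openin (top_of_set U) (U \<inter> \<phi> -` (top_of_set Y interior_of A))"
      by (rule continuous_openin_preimage[OF cont maps openin_interior_of])
    then have G: "open G"
      using U by (simp add: G_def Int_commute openin_open_eq)
    have G_le: "emeasure (\<mu> n) G \<le> emeasure (\<nu> n) A" if n: "n \<ge> 1" for n
      unfolding emeasure_\<nu>[OF n A] G_def
      using interior_of_subset[of "top_of_set Y" A] emeasure_\<nu>(2)[OF n A]
      by (intro emeasure_mono) auto
    have "- ?li \<le> rate t" if t: "t \<in> G" for t
    proof -
      obtain \<xi> where \<xi>: "\<xi> \<in> interior D" "GDERIV \<Lambda> \<xi> :> t" "rate t = ereal (\<xi> \<bullet> t - \<Lambda> \<xi>)"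
        using exposed t by (auto simp: G_def)
      show ?thesis
      proof (rule ereal_le_epsilon2)
        fix \<epsilon> :: real assume \<epsilon>: "0 < \<epsilon>"
        have "ereal (- (\<xi> \<bullet> t - \<Lambda> \<xi> + \<epsilon>)) \<le> ?li"
        proof (rule liminf_ln_ereal_ge[of "1 / 2"])
          show "\<forall>\<^sub>F n in sequentially. ennreal (1 / 2 * exp (- (real n * (\<xi> \<bullet> t - \<Lambda> \<xi> + \<epsilon>)))) \<le> emeasure (\<nu> n) A"
            using open_bound[OF G t \<xi>(1,2) \<epsilon>] eventually_ge_at_top[of 1]
            by eventually_elim (use G_le order_trans in fastforce)
        qed simp
        then have "- ?li \<le> - ereal (- (\<xi> \<bullet> t - \<Lambda> \<xi> + \<epsilon>))" by (simp only: ereal_minus_le_minus)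
        then show "- ?li \<le> rate t + ereal \<epsilon>" by (simp add: \<xi>(3) algebra_simps)
      qed
    qed
    then have "- ?li \<le> I y" if "y \<in> top_of_set Y interior_of A" for y
      unfolding I_def using that by (intro INF_greatest) (auto simp: G_def)
    then have "- ?li \<le> (INF y \<in> top_of_set Y interior_of A. I y)" by (intro INF_greatest)
    then show "- (INF y \<in> top_of_set Y interior_of A. I y) \<le> ?li"
      by (simp add: ereal_uminus_le_reorder)
    have "A \<subseteq> Y" using A sets.sets_into_space[OF A] by (simp add: space_restrict_space)
    then have A_cl: "A \<subseteq> top_of_set Y closure_of A" by (intro closure_of_subset) simp
    have "closedin (top_of_set U) (U \<inter> \<phi> -` (top_of_set Y closure_of A))"
      by (rule continuous_closedin_preimage_gen[OF cont _ closedin_closure_of]) (use maps in auto)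
    then obtain F where F: "closed F" "U \<inter> \<phi> -` (top_of_set Y closure_of A) = U \<inter> F"
      by (auto simp: closedin_closed)
    show "?ls \<le> - (INF y \<in> top_of_set Y closure_of A. I y)"
    proof (rule ccontr)
      assume "\<not> ?thesis"
      then have "- ?ls < (INF y \<in> top_of_set Y closure_of A. I y)"
        by (simp add: not_le ereal_uminus_less_reorder)
      then obtain \<eta> where \<eta>: "- ?ls < ereal \<eta>" "ereal \<eta> < (INF y \<in> top_of_set Y closure_of A. I y)"
        using ereal_dense2 by blast
      have "ereal \<eta> < rate t" if t: "t \<in> F" for t
      proof (cases "t \<in> U")
        case True
        then have "\<phi> t \<in> top_of_set Y closure_of A" using F(2) t by blast
        then have "(INF y \<in> top_of_set Y closure_of A. I y) \<le> I (\<phi> t)" by (rule INF_lower)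
        also have "\<dots> \<le> rate t" by (rule I_le[OF True])
        finally show ?thesis by (rule less_le_trans[OF \<eta>(2)])
      qed (simp add: outside)
      then obtain C \<eta>' where C: "C > 0" "\<eta>' > \<eta>"
        "\<And>n. n \<ge> 1 \<Longrightarrow> emeasure (\<mu> n) F \<le> ennreal (C * exp (- (real n * \<eta>')))"
        using closed_bound[OF F(1), of \<eta>] unfolding less_rate_iff by blast
      have "?ls \<le> ereal (- \<eta>')"
      proof (rule limsup_ln_ereal_le[OF C(1)])
        show "\<forall>\<^sub>F n in sequentially. emeasure (\<nu> n) A \<le> ennreal (C * exp (- (real n * \<eta>')))"
          using eventually_ge_at_top[of 1]
        proof eventually_elim
          case (elim n)
          have "emeasure (\<nu> n) A \<le> emeasure (\<mu> n) F"
            unfolding emeasure_\<nu>(1)[OF elim A] using F A_cl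
            by (intro emeasure_mono) (auto simp: sets_eq[OF elim])
          then show ?case using C(3)[OF elim] by (rule order_trans)
        qed
      qed
      also have "\<dots> < ereal (- \<eta>)" using C(2) by simp
      finally show False using \<eta>(1) by (simp add: ereal_uminus_less_reorder)
    qed
  qed
  show ?thesis
    unfolding large_deviation_principle_def sigma_sets_top_of_set I_def[symmetric] \<nu>_def[symmetric]
    using prob_\<nu> rate_fun bounds by (auto simp: \<nu>_def space_restrict_space intro!: Liminf_le_Limsup)
qed

end

section \<open>Laplace transforms and exponential families\<close>

lemma abs_exp_remainder_le:
  fixes u :: real shows "\<bar>exp u - 1 - u\<bar> \<le> u\<^sup>2 * exp \<bar>u\<bar>"
proof -
  obtain s where s: "\<bar>s\<bar> \<le> \<bar>u\<bar>" "exp u = (\<Sum>m<2. u ^ m / fact m) + (exp s / fact 2) * u ^ 2"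
    using Maclaurin_exp_le[of u 2] by blast
  have "\<bar>exp u - 1 - u\<bar> = u\<^sup>2 * (exp s / 2)"
    using s(2) by (simp add: eval_nat_numeral)
  also have "exp s / 2 \<le> exp \<bar>u\<bar>"
    using s(1) exp_gt_zero[of s] exp_le_cancel_iff[of s "\<bar>u\<bar>"] by linarith
  finally show ?thesis by (simp add: mult_left_mono)
qed

lemma exp_norm_le_sum_Basis:
  fixes x :: "'a::euclidean_space"
  assumes "r \<ge> 0"
  shows "exp (r * norm x) \<le> (\<Sum>b\<in>Basis. exp (r * real DIM('a) * (b \<bullet> x)) + exp (- (r * real DIM('a) * (b \<bullet> x))))"
proof -
  obtain b :: 'a where b: "b \<in> Basis" "norm x \<le> real DIM('a) * \<bar>b \<bullet> x\<bar>"
  proof (rule ccontr)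
    assume "\<not> thesis"
    then have "\<bar>x \<bullet> b\<bar> < norm x / real DIM('a)" if "b \<in> Basis" for b
      using that \<open>\<And>b. b \<in> Basis \<Longrightarrow> norm x \<le> real DIM('a) * \<bar>b \<bullet> x\<bar> \<Longrightarrow> thesis\<close>
      by (fastforce simp: field_simps inner_commute not_le)
    then have "(\<Sum>b\<in>Basis. \<bar>x \<bullet> b\<bar>) < (\<Sum>b::'a\<in>Basis. norm x / real DIM('a))"
      by (intro sum_strict_mono) auto
    also have "\<dots> = norm x" by simp
    finally show False using norm_le_l1[of x] by simp
  qed
  have "exp (r * norm x) \<le> exp (r * (real DIM('a) * \<bar>b \<bullet> x\<bar>))"
    using b assms by (auto intro!: mult_left_mono)
  also have "\<dots> \<le> exp (r * real DIM('a) * (b \<bullet> x)) + exp (- (r * real DIM('a) * (b \<bullet> x)))"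
    by (cases "b \<bullet> x \<ge> 0") (auto simp: mult.assoc)
  also have "\<dots> \<le> (\<Sum>b\<in>Basis. exp (r * real DIM('a) * (b \<bullet> x)) + exp (- (r * real DIM('a) * (b \<bullet> x))))"
    using b by (intro member_le_sum) auto
  finally show ?thesis .
qed

text \<open>The mass of \<open>L\<close> may be infinite; it must not vanish, since otherwise the
cumulant generating function would be \<open>-\<infinity>\<close>.\<close>

locale laplace_transform =
  fixes L :: "'a::euclidean_space measure"
  assumes sets_L [measurable_cong]: "sets L = sets borel"
    and nonzero: "emeasure L UNIV \<noteq> 0"
begin

abbreviation "\<kappa> \<theta> \<equiv> real_of_ereal (cumulant L \<theta>)"
abbreviation "P \<equiv> exp_family L"
abbreviation "\<Theta>\<^sub>0 \<equiv> finite_domain L"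

lemma space_L: "space L = UNIV"
  using sets_eq_imp_space_eq[OF sets_L] by simp

lemma laplace_nonzero: "(\<integral>\<^sup>+ x. ennreal (exp (\<theta> \<bullet> x)) \<partial>L) \<noteq> 0"
proof
  assume "(\<integral>\<^sup>+ x. ennreal (exp (\<theta> \<bullet> x)) \<partial>L) = 0"
  then have "AE x in L. False" by (subst (asm) nn_integral_0_iff_AE) auto
  then show False using nonzero by (simp add: AE_iff_null null_sets_def space_L)
qed

lemma finite_domain_iff: "\<theta> \<in> \<Theta>\<^sub>0 \<longleftrightarrow> (\<integral>\<^sup>+ x. ennreal (exp (\<theta> \<bullet> x)) \<partial>L) < \<infinity>"
  by (auto simp: finite_domain_def cumulant_def ln_ereal_def top.not_eq_extremum)

lemma laplace_eq_exp_cumulant: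
  assumes "\<theta> \<in> \<Theta>\<^sub>0"
  shows "(\<integral>\<^sup>+ x. ennreal (exp (\<theta> \<bullet> x)) \<partial>L) = ennreal (exp (\<kappa> \<theta>))"
proof -
  let ?Z = "\<integral>\<^sup>+ x. ennreal (exp (\<theta> \<bullet> x)) \<partial>L"
  have Z: "?Z \<noteq> 0" "?Z < \<infinity>" using assms laplace_nonzero finite_domain_iff by auto
  then have "0 < enn2real ?Z" by (simp add: enn2real_positive_iff zero_less_iff_neq_zero)
  moreover have "\<kappa> \<theta> = ln (enn2real ?Z)" using Z by (simp add: cumulant_def ln_ereal_def)
  ultimately show ?thesis using Z by simp
qed

lemma sets_P [measurable_cong]: "sets (P \<theta>) = sets borel"
  by (simp add: exp_family_def sets_L)

lemma space_P: "space (P \<theta>) = UNIV"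
  by (simp add: exp_family_def space_L)

lemma AE_P_iff: "(AE x in P \<theta>. Q x) \<longleftrightarrow> (AE x in L. Q x)"
  unfolding exp_family_def by (subst AE_density) auto

lemma nn_integral_P:
  assumes [measurable]: "f \<in> borel_measurable borel"
  shows "(\<integral>\<^sup>+ x. f x \<partial>P \<theta>) = (\<integral>\<^sup>+ x. ennreal (exp (\<theta> \<bullet> x - \<kappa> \<theta>)) * f x \<partial>L)"
  unfolding exp_family_def by (rule nn_integral_density) auto

lemma nn_integral_exp_P:
  "(\<integral>\<^sup>+ x. ennreal (exp (\<xi> \<bullet> x)) \<partial>P \<theta>)
    = ennreal (exp (- \<kappa> \<theta>)) * (\<integral>\<^sup>+ x. ennreal (exp ((\<theta> + \<xi>) \<bullet> x)) \<partial>L)"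
proof -
  have "(\<integral>\<^sup>+ x. ennreal (exp (\<xi> \<bullet> x)) \<partial>P \<theta>)
      = (\<integral>\<^sup>+ x. ennreal (exp (- \<kappa> \<theta>)) * ennreal (exp ((\<theta> + \<xi>) \<bullet> x)) \<partial>L)"
    by (subst nn_integral_P)
       (auto intro!: nn_integral_cong simp: ennreal_mult[symmetric] exp_add[symmetric] inner_add_left algebra_simps)
  then show ?thesis by (subst (asm) nn_integral_cmult) auto
qed

lemma nn_integral_exp_P_finite_domain:
  assumes "\<theta> + \<xi> \<in> \<Theta>\<^sub>0"
  shows "(\<integral>\<^sup>+ x. ennreal (exp (\<xi> \<bullet> x)) \<partial>P \<theta>) = ennreal (exp (\<kappa> (\<theta> + \<xi>) - \<kappa> \<theta>))"
  unfolding nn_integral_exp_P laplace_eq_exp_cumulant[OF assms]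
  by (simp add: ennreal_mult[symmetric] exp_add[symmetric])

lemma add_in_finite_domain_iff:
  "\<theta> + \<xi> \<in> \<Theta>\<^sub>0 \<longleftrightarrow> (\<integral>\<^sup>+ x. ennreal (exp (\<xi> \<bullet> x)) \<partial>P \<theta>) < \<infinity>"
  unfolding nn_integral_exp_P finite_domain_iff
  by (auto simp: ennreal_mult_less_top ennreal_zero_less_mult_iff)

lemma prob_space_P:
  assumes "\<theta> \<in> \<Theta>\<^sub>0" shows "prob_space (P \<theta>)"
  using nn_integral_exp_P_finite_domain[of \<theta> 0] assms by (intro prob_spaceI) (simp add: space_P)

lemma integrable_exp_P:
  assumes "\<theta> + \<xi> \<in> \<Theta>\<^sub>0"
  shows "integrable (P \<theta>) (\<lambda>x. exp (\<xi> \<bullet> x))"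
    and "(\<integral>x. exp (\<xi> \<bullet> x) \<partial>P \<theta>) = exp (\<kappa> (\<theta> + \<xi>) - \<kappa> \<theta>)"
proof -
  show "integrable (P \<theta>) (\<lambda>x. exp (\<xi> \<bullet> x))"
    using assms by (intro integrableI_bounded) (auto simp: nn_integral_exp_P_finite_domain)
  show "(\<integral>x. exp (\<xi> \<bullet> x) \<partial>P \<theta>) = exp (\<kappa> (\<theta> + \<xi>) - \<kappa> \<theta>)"
    using assms by (subst integral_eq_nn_integral) (auto simp: nn_integral_exp_P_finite_domain)
qed

lemma convex_finite_domain: "convex \<Theta>\<^sub>0"
proof (rule convexI)
  fix \<theta> \<theta>' :: 'a and u v :: real
  assume uv: "0 \<le> u" "0 \<le> v" "u + v = 1" and \<theta>: "\<theta> \<in> \<Theta>\<^sub>0" "\<theta>' \<in> \<Theta>\<^sub>0"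
  have "(\<integral>\<^sup>+ x. ennreal (exp ((u *\<^sub>R \<theta> + v *\<^sub>R \<theta>') \<bullet> x)) \<partial>L)
      \<le> (\<integral>\<^sup>+ x. ennreal u * ennreal (exp (\<theta> \<bullet> x)) + ennreal v * ennreal (exp (\<theta>' \<bullet> x)) \<partial>L)"
  proof (rule nn_integral_mono)
    fix x
    have "exp (u *\<^sub>R (\<theta> \<bullet> x) + v *\<^sub>R (\<theta>' \<bullet> x)) \<le> u * exp (\<theta> \<bullet> x) + v * exp (\<theta>' \<bullet> x)"
      using exp_convex uv unfolding convex_on_def by blast
    then show "ennreal (exp ((u *\<^sub>R \<theta> + v *\<^sub>R \<theta>') \<bullet> x))
        \<le> ennreal u * ennreal (exp (\<theta> \<bullet> x)) + ennreal v * ennreal (exp (\<theta>' \<bullet> x))"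
      using uv by (simp add: ennreal_mult[symmetric] ennreal_plus[symmetric] inner_add_left
        ennreal_leI del: ennreal_plus)
  qed
  also have "\<dots> = ennreal u * (\<integral>\<^sup>+ x. ennreal (exp (\<theta> \<bullet> x)) \<partial>L) + ennreal v * (\<integral>\<^sup>+ x. ennreal (exp (\<theta>' \<bullet> x)) \<partial>L)"
    by (subst nn_integral_add) (auto simp: nn_integral_cmult)
  also have "\<dots> < \<infinity>"
    using \<theta> by (simp add: finite_domain_iff ennreal_mult_less_top)
  finally show "u *\<^sub>R \<theta> + v *\<^sub>R \<theta>' \<in> \<Theta>\<^sub>0" by (simp add: finite_domain_iff)
qed

text \<open>The exponential of the norm is dominated by finitely many exponentials of linear
functions, one for each signed coordinate axis. This is the domination behind the differentiability
of \<open>\<kappa>\<close>.\<close>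

lemma integrable_exp_norm:
  assumes "\<theta> \<in> interior \<Theta>\<^sub>0"
  obtains r where "r > 0" "cball \<theta> r \<subseteq> \<Theta>\<^sub>0" "integrable (P \<theta>) (\<lambda>x. exp (r * norm x))"
proof -
  obtain \<rho> where \<rho>: "\<rho> > 0" "cball \<theta> \<rho> \<subseteq> \<Theta>\<^sub>0" using assms by (auto simp: mem_interior_cball)
  define r where "r = \<rho> / real DIM('a)"
  have DIM: "real DIM('a) \<ge> 1" using DIM_positive[where 'a='a] by linarith
  have r: "r > 0" "r \<le> \<rho>" "r * real DIM('a) = \<rho>"
    using \<rho> DIM by (auto simp: r_def field_simps)
  have "integrable (P \<theta>) (\<lambda>x. exp (r * norm x))"
  proof (rule Bochner_Integration.integrable_bound)
    have "integrable (P \<theta>) (\<lambda>x. exp ((\<rho> *\<^sub>R b) \<bullet> x) + exp ((- \<rho> *\<^sub>R b) \<bullet> x))" if "b \<in> Basis" for b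
      using that \<rho> by (intro Bochner_Integration.integrable_add integrable_exp_P subsetD[OF \<rho>(2)])
                      (auto simp: dist_norm)
    then show "integrable (P \<theta>) (\<lambda>x. \<Sum>b\<in>Basis. exp ((\<rho> *\<^sub>R b) \<bullet> x) + exp ((- \<rho> *\<^sub>R b) \<bullet> x))"
      by (rule Bochner_Integration.integrable_sum)
    show "AE x in P \<theta>. norm (exp (r * norm x)) \<le> norm (\<Sum>b\<in>Basis. exp ((\<rho> *\<^sub>R b) \<bullet> x) + exp ((- \<rho> *\<^sub>R b) \<bullet> x))"
    proof (rule AE_I2)
      fix x :: 'a
      have "exp (r * norm x) \<le> (\<Sum>b\<in>Basis. exp ((\<rho> *\<^sub>R b) \<bullet> x) + exp ((- \<rho> *\<^sub>R b) \<bullet> x))"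
        using exp_norm_le_sum_Basis[of r x] r by simp
      then show "norm (exp (r * norm x)) \<le> norm (\<Sum>b\<in>Basis. exp ((\<rho> *\<^sub>R b) \<bullet> x) + exp ((- \<rho> *\<^sub>R b) \<bullet> x))"
        by simp
    qed
  qed auto
  moreover have "cball \<theta> r \<subseteq> \<Theta>\<^sub>0" using subset_cball[OF r(2)] \<rho>(2) by blast
  ultimately show ?thesis using that r by blast
qed

definition mean :: "'a \<Rightarrow> 'a" where "mean \<theta> = (\<integral>x. x \<partial>P \<theta>)"

lemma integrable_P_id:
  assumes "\<theta> \<in> interior \<Theta>\<^sub>0"
  shows "integrable (P \<theta>) (\<lambda>x. x)"
proof -
  obtain r where r: "r > 0" "cball \<theta> r \<subseteq> \<Theta>\<^sub>0" "integrable (P \<theta>) (\<lambda>x. exp (r * norm x))"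
    using integrable_exp_norm[OF assms] .
  have "norm x \<le> norm (exp (r * norm x) / r)" for x :: 'a
  proof -
    have "r * norm x \<le> exp (r * norm x)" using exp_ge_add_one_self[of "r * norm x"] by linarith
    then show ?thesis using r by (simp add: field_simps)
  qed
  then show ?thesis
    by (intro Bochner_Integration.integrable_bound[OF integrable_divide[OF r(3), of r]]) auto
qed

lemma integral_P_inner:
  assumes "\<theta> \<in> interior \<Theta>\<^sub>0"
  shows "integrable (P \<theta>) (\<lambda>x. a \<bullet> x)" "(\<integral>x. a \<bullet> x \<partial>P \<theta>) = a \<bullet> mean \<theta>"
  using integrable_P_id[OF assms] unfolding mean_def by auto

text \<open>With \<open>h = y - \<theta>\<close>, the quotient
\<open>exp (\<kappa> y - \<kappa> \<theta>)\<close> is the integral of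
\<open>exp (h \<bullet> x)\<close> under \<open>P \<theta>\<close>. The second-order remainder of
the exponential is bounded by \<open>(norm h)\<^sup>2\<close> times a fixed integrable function, so
the linear part, the integral of \<open>h \<bullet> x\<close>, is the derivative.\<close>

lemma GDERIV_cumulant:
  assumes \<theta>: "\<theta> \<in> interior \<Theta>\<^sub>0"
  shows "GDERIV \<kappa> \<theta> :> mean \<theta>"
proof -
  obtain r where r: "r > 0" "cball \<theta> r \<subseteq> \<Theta>\<^sub>0" "integrable (P \<theta>) (\<lambda>x. exp (r * norm x))"
    using integrable_exp_norm[OF \<theta>] .
  have "\<theta> \<in> \<Theta>\<^sub>0" using \<theta> interior_subset by blast
  interpret P: prob_space "P \<theta>" by (rule prob_space_P) fact
  define W where "W y = exp (\<kappa> y - \<kappa> \<theta>)" for y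
  \<comment> \<open>The constant comes from \<open>z \<le> exp z\<close> at \<open>z = r * norm x / 4\<close>, squared; the other half of the
    exponent \<open>r * norm x\<close> pays for \<open>exp \<bar>h \<bullet> x\<bar>\<close>.\<close>
  define C where "C = (16 / r\<^sup>2) * (\<integral>x. exp (r * norm x) \<partial>P \<theta>)"
  have quad: "\<bar>W y - W \<theta> - (y - \<theta>) \<bullet> mean \<theta>\<bar> \<le> (norm (y - \<theta>))\<^sup>2 * C"
    if y: "norm (y - \<theta>) \<le> r / 2" for y
  proof -
    define h where "h = y - \<theta>"
    have h: "norm h \<le> r / 2" "y = \<theta> + h" using y by (auto simp: h_def)
    have "y \<in> \<Theta>\<^sub>0" using r y by (intro subsetD[OF r(2)]) (auto simp: dist_norm norm_minus_commute)
    then have dom: "\<theta> + h \<in> \<Theta>\<^sub>0" by (simp add: h_def)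
    note int = integrable_exp_P[OF dom] integral_P_inner[OF \<theta>, of h]
    have int3: "integrable (P \<theta>) (\<lambda>x. exp (h \<bullet> x) - 1 - h \<bullet> x)"
      using int by auto
    have eq: "W y - W \<theta> - h \<bullet> mean \<theta> = (\<integral>x. exp (h \<bullet> x) - 1 - h \<bullet> x \<partial>P \<theta>)"
      using int by (simp add: W_def h P.prob_space)
    also have "\<bar>\<dots>\<bar> \<le> (\<integral>x. (norm h)\<^sup>2 * ((16 / r\<^sup>2) * exp (r * norm x)) \<partial>P \<theta>)"
    proof (rule integral_abs_bound[THEN order_trans], rule integral_mono)
      show "integrable (P \<theta>) (\<lambda>x. \<bar>exp (h \<bullet> x) - 1 - h \<bullet> x\<bar>)" using int3 by auto
      show "integrable (P \<theta>) (\<lambda>x. (norm h)\<^sup>2 * ((16 / r\<^sup>2) * exp (r * norm x)))" using r by auto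
      fix x
      have hx: "\<bar>h \<bullet> x\<bar> \<le> norm h * norm x" by (rule Cauchy_Schwarz_ineq2)
      have "(norm x * (r / 4))\<^sup>2 \<le> (exp (norm x * (r / 4)))\<^sup>2"
        using exp_ge_add_one_self[of "norm x * (r / 4)"] r(1)
        by (intro power_mono) (linarith, simp)
      then have *: "(norm x)\<^sup>2 \<le> (16 / r\<^sup>2) * exp (norm x * (r / 2))"
        using r(1) by (simp add: power_mult_distrib exp_double[symmetric] field_simps)
      have "\<bar>exp (h \<bullet> x) - 1 - h \<bullet> x\<bar> \<le> (h \<bullet> x)\<^sup>2 * exp \<bar>h \<bullet> x\<bar>" by (rule abs_exp_remainder_le)
      also have "(h \<bullet> x)\<^sup>2 \<le> (norm h)\<^sup>2 * (norm x)\<^sup>2"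
        using power_mono[OF hx, of 2] by (simp add: power_mult_distrib)
      also have "exp \<bar>h \<bullet> x\<bar> \<le> exp (norm x * (r / 2))"
        using order_trans[OF hx mult_right_mono[OF h(1) norm_ge_zero[of x]]] by (simp add: mult.commute)
      also have "(norm h)\<^sup>2 * (norm x)\<^sup>2 * exp (norm x * (r / 2))
          \<le> (norm h)\<^sup>2 * ((16 / r\<^sup>2) * exp (norm x * (r / 2))) * exp (norm x * (r / 2))"
        using * by (intro mult_left_mono mult_right_mono) auto
      also have "\<dots> = (norm h)\<^sup>2 * ((16 / r\<^sup>2) * exp (r * norm x))"
        by (simp add: exp_add[symmetric] mult.commute)
      finally show "\<bar>exp (h \<bullet> x) - 1 - h \<bullet> x\<bar> \<le> (norm h)\<^sup>2 * ((16 / r\<^sup>2) * exp (r * norm x))"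
        by (simp add: mult_left_mono mult_right_mono)
    qed
    also have "\<dots> = (norm h)\<^sup>2 * C" by (simp add: C_def)
    finally show ?thesis by (simp add: h_def)
  qed
  have "(W has_derivative (\<lambda>h. h \<bullet> mean \<theta>)) (at \<theta>)"
  proof (rule has_derivativeI_sandwich[of "r / 2"])
    show "0 < r / 2" using r by simp
    show "bounded_linear (\<lambda>h. h \<bullet> mean \<theta>)" by (rule bounded_linear_inner_left)
    show "norm (W y - W \<theta> - (y - \<theta>) \<bullet> mean \<theta>) / norm (y - \<theta>) \<le> norm (y - \<theta>) * C"
      if "y \<in> UNIV" "y \<noteq> \<theta>" "dist y \<theta> < r / 2" for y
      using quad[of y] that by (simp add: dist_norm field_simps power2_eq_square)
    show "((\<lambda>y. norm (y - \<theta>) * C) \<longlongrightarrow> 0) (at \<theta>)"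
      by (rule tendsto_eq_intros refl | simp)+
  qed
  then have "((\<lambda>y. ln (W y)) has_derivative (\<lambda>h. h \<bullet> mean \<theta> * inverse (W \<theta>))) (at \<theta>)"
    by (rule has_derivative_ln[rotated]) (simp add: W_def)
  then have "((\<lambda>y. \<kappa> \<theta> + ln (W y)) has_derivative (\<lambda>h. 0 + h \<bullet> mean \<theta> * inverse (W \<theta>))) (at \<theta>)"
    by (intro has_derivative_add has_derivative_const)
  then show ?thesis by (simp add: gderiv_def W_def)
qed

lemma grad_cumulant_eq_mean:
  assumes "\<theta> \<in> interior \<Theta>\<^sub>0" shows "grad_cumulant L \<theta> = mean \<theta>"
  unfolding grad_cumulant_def grad_def
proof (rule the_equality)
  show "GDERIV \<kappa> \<theta> :> mean \<theta>" by (rule GDERIV_cumulant) fact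
  fix D assume "GDERIV \<kappa> \<theta> :> D"
  then have "(\<lambda>h. h \<bullet> D) = (\<lambda>h. h \<bullet> mean \<theta>)"
    using GDERIV_cumulant[OF assms] unfolding gderiv_def by (rule has_derivative_unique)
  then show "D = mean \<theta>" using vector_eq_ldot[of D "mean \<theta>"] by (simp add: fun_eq_iff)
qed

text \<open>Jensen's inequality for the exponential function under \<open>P \<theta>\<close>,
written out with the tangent of the exponential at
\<open>c = (y - \<theta>) \<bullet> mean \<theta>\<close>.\<close>

lemma cumulant_above_tangent:
  assumes \<theta>: "\<theta> \<in> interior \<Theta>\<^sub>0" and y: "y \<in> \<Theta>\<^sub>0"
  shows "\<kappa> \<theta> + (y - \<theta>) \<bullet> mean \<theta> \<le> \<kappa> y"
proof -
  interpret P: prob_space "P \<theta>" by (rule prob_space_P[OF subsetD[OF interior_subset \<theta>]])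
  define c where "c = (y - \<theta>) \<bullet> mean \<theta>"
  have y': "\<theta> + (y - \<theta>) \<in> \<Theta>\<^sub>0" using y by simp
  note int = integrable_exp_P[OF y'] integral_P_inner[OF \<theta>, of "y - \<theta>"]
  have "exp c = (\<integral>x. exp c * (1 + (y - \<theta>) \<bullet> x - c) \<partial>P \<theta>)"
    using int by (simp add: P.prob_space c_def)
  also have "\<dots> \<le> (\<integral>x. exp ((y - \<theta>) \<bullet> x) \<partial>P \<theta>)"
  proof (rule integral_mono)
    fix x
    have "exp c * (1 + ((y - \<theta>) \<bullet> x - c)) \<le> exp c * exp ((y - \<theta>) \<bullet> x - c)"
      by (intro mult_left_mono exp_ge_add_one_self) auto
    then show "exp c * (1 + (y - \<theta>) \<bullet> x - c) \<le> exp ((y - \<theta>) \<bullet> x)"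
      by (simp add: exp_add[symmetric] algebra_simps)
  qed (use int in auto)
  also have "\<dots> = exp (\<kappa> y - \<kappa> \<theta>)" using int(2) by simp
  finally show ?thesis by (simp add: c_def)
qed

text \<open>The log-likelihood ratio is an affine function of \<open>x\<close>, so its integral is determined by the mean.\<close>

lemma kl_div_eq:
  assumes "sigma_finite_measure L" and \<theta>: "\<theta> \<in> interior \<Theta>\<^sub>0"
  shows "kl_div L \<theta> \<theta>' = (\<theta> - \<theta>') \<bullet> mean \<theta> - \<kappa> \<theta> + \<kappa> \<theta>'"
proof -
  interpret L: sigma_finite_measure L by fact
  interpret P: prob_space "P \<theta>" by (rule prob_space_P[OF subsetD[OF interior_subset \<theta>]])
  have "kl_div L \<theta> \<theta>' = (\<integral>x. exp (\<theta> \<bullet> x - \<kappa> \<theta>) * log (exp 1) (exp (\<theta> \<bullet> x - \<kappa> \<theta>) / exp (\<theta>' \<bullet> x - \<kappa> \<theta>')) \<partial>L)"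
    unfolding kl_div_def exp_family_def by (rule L.KL_density_density) auto
  also have "\<dots> = (\<integral>x. exp (\<theta> \<bullet> x - \<kappa> \<theta>) *\<^sub>R ((\<theta> - \<theta>') \<bullet> x - \<kappa> \<theta> + \<kappa> \<theta>') \<partial>L)"
    by (simp add: exp_diff[symmetric] log_def inner_diff_left algebra_simps)
  also have "\<dots> = (\<integral>x. (\<theta> - \<theta>') \<bullet> x - \<kappa> \<theta> + \<kappa> \<theta>' \<partial>P \<theta>)"
    unfolding exp_family_def by (rule integral_density[symmetric]) auto
  also have "\<dots> = (\<theta> - \<theta>') \<bullet> mean \<theta> - \<kappa> \<theta> + \<kappa> \<theta>'"
    using integral_P_inner[OF \<theta>, of "\<theta> - \<theta>'"] by (simp add: P.prob_space)
  finally show ?thesis .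
qed

text \<open>A separating hyperplane gives a weak inequality on the convex set
\<open>mean_domain L\<close>; it is strict because that set is open.\<close>

lemma mean_domain_separation:
  assumes full: "emeasure L (- mean_domain L) = 0" and t: "t \<notin> mean_domain L"
  obtains a where "a \<noteq> 0" "\<And>x. x \<in> mean_domain L \<Longrightarrow> a \<bullet> x < a \<bullet> t"
proof -
  have "mean_domain L \<noteq> {}" using full nonzero by (metis Compl_empty_eq)
  then obtain a b where ab: "a \<noteq> 0" "\<forall>x\<in>mean_domain L. a \<bullet> x \<le> b" "b \<le> a \<bullet> t"
    using separating_hyperplane_sets[of "mean_domain L" "{t}"] t convex_convex_support
    by (auto simp: mean_domain_def convex_interior)
  have "a \<bullet> x < a \<bullet> t" if x: "x \<in> mean_domain L" for x
  proof -
    obtain e where e: "e > 0" "cball x e \<subseteq> mean_domain L"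
      using x unfolding mean_domain_def by (metis interior_interior mem_interior_cball)
    have "x + (e / norm a) *\<^sub>R a \<in> cball x e" using ab e by (simp add: dist_norm)
    then have "a \<bullet> (x + (e / norm a) *\<^sub>R a) \<le> b" using ab e by blast
    moreover have "0 < (e / norm a) * (a \<bullet> a)" using ab e by simp
    ultimately show ?thesis using ab by (simp add: inner_add_right)
  qed
  then show ?thesis using that ab by blast
qed

lemma AE_mean_domain:
  assumes "emeasure L (- mean_domain L) = 0"
  shows "AE x in L. x \<in> mean_domain L"
proof (rule AE_I')
  show "- mean_domain L \<in> null_sets L"
    using assms by (auto simp: null_sets_def sets_L mean_domain_def intro!: borel_closed)
qed auto

lemma mean_in_mean_domain:
  assumes full: "emeasure L (- mean_domain L) = 0" and \<theta>: "\<theta> \<in> interior \<Theta>\<^sub>0"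
  shows "mean \<theta> \<in> mean_domain L"
proof (rule ccontr)
  interpret P: prob_space "P \<theta>" by (rule prob_space_P[OF subsetD[OF interior_subset \<theta>]])
  assume "mean \<theta> \<notin> mean_domain L"
  then obtain a where a: "\<And>x. x \<in> mean_domain L \<Longrightarrow> a \<bullet> x < a \<bullet> mean \<theta>"
    using mean_domain_separation[OF full] by blast
  have "(\<integral>x. a \<bullet> x \<partial>P \<theta>) < (\<integral>x. a \<bullet> mean \<theta> \<partial>P \<theta>)"
    using integral_P_inner[OF \<theta>] AE_mean_domain[OF full] a
    by (intro P.integral_less_AE_space) (auto simp: AE_P_iff P.emeasure_space_1)
  then show False using integral_P_inner[OF \<theta>] by (simp add: P.prob_space)
qed

text \<open>Take the direction \<open>a\<close> of a hyperplane separating \<open>t\<close> from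
\<open>mean_domain L\<close>. Since \<open>a \<bullet> x < a \<bullet> t\<close> almost everywhere,
the integral of \<open>exp (n * (a \<bullet> x - a \<bullet> t))\<close> tends to 0 by dominated
convergence, so \<open>\<theta> + n a\<close> stays in the domain and its contribution to the
conjugate at \<open>t\<close> grows without bound.\<close>

lemma conjugate_infinite_outside_mean_domain:
  assumes full: "emeasure L (- mean_domain L) = 0"
    and \<theta>: "\<theta> \<in> \<Theta>\<^sub>0" and t: "t \<notin> mean_domain L"
  shows "\<exists>y\<in>\<Theta>\<^sub>0. \<eta> < (y - \<theta>) \<bullet> t - (\<kappa> y - \<kappa> \<theta>)"
proof -
  interpret P: prob_space "P \<theta>" by (rule prob_space_P) fact
  obtain a where a: "\<And>x. x \<in> mean_domain L \<Longrightarrow> a \<bullet> x < a \<bullet> t"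
    using mean_domain_separation[OF full t] by blast
  define f where "f n x = exp (real n * (a \<bullet> x - a \<bullet> t))" for n :: nat and x
  have AE: "AE x in P \<theta>. a \<bullet> x < a \<bullet> t"
    using AE_mean_domain[OF full] a by (auto simp: AE_P_iff)
  have f_le: "AE x in P \<theta>. f n x \<le> 1" for n
    using AE by eventually_elim (auto simp: f_def mult_nonneg_nonpos)
  have "(\<lambda>n. \<integral>\<^sup>+ x. ennreal (f n x) \<partial>P \<theta>) \<longlonglongrightarrow> (\<integral>\<^sup>+ x. 0 \<partial>P \<theta>)"
  proof (rule nn_integral_dominated_convergence[where w="\<lambda>_. 1"])
    show "AE x in P \<theta>. (\<lambda>n. ennreal (f n x)) \<longlonglongrightarrow> 0"
      using AE
    proof eventually_elim
      case (elim x)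
      have "(\<lambda>n. exp (a \<bullet> x - a \<bullet> t) ^ n) \<longlonglongrightarrow> 0"
        using elim by (intro LIMSEQ_power_zero) auto
      then have "(\<lambda>n. f n x) \<longlonglongrightarrow> 0" by (simp add: f_def exp_of_nat_mult)
      then show ?case using tendsto_ennrealI by force
    qed
  qed (use f_le in \<open>auto simp: f_def P.emeasure_space_1 ennreal_le_1\<close>)
  then have "\<forall>\<^sub>F n in sequentially. (\<integral>\<^sup>+ x. ennreal (f n x) \<partial>P \<theta>) < ennreal (exp (- \<eta>))"
    by (intro order_tendstoD) auto
  then obtain n where n: "(\<integral>\<^sup>+ x. ennreal (f n x) \<partial>P \<theta>) < ennreal (exp (- \<eta>))"
    by (auto simp: eventually_sequentially)
  define \<xi> where "\<xi> = real n *\<^sub>R a"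
  have eq: "(\<integral>\<^sup>+ x. ennreal (exp (\<xi> \<bullet> x)) \<partial>P \<theta>) = ennreal (exp (\<xi> \<bullet> t)) * (\<integral>\<^sup>+ x. ennreal (f n x) \<partial>P \<theta>)"
    by (subst nn_integral_cmult[symmetric])
       (auto simp: f_def \<xi>_def ennreal_mult[symmetric] exp_add[symmetric] algebra_simps)
  also have "\<dots> < ennreal (exp (\<xi> \<bullet> t)) * ennreal (exp (- \<eta>))"
    using n by (intro ennreal_mult_strict_left_mono) auto
  finally have less: "(\<integral>\<^sup>+ x. ennreal (exp (\<xi> \<bullet> x)) \<partial>P \<theta>) < ennreal (exp (\<xi> \<bullet> t - \<eta>))"
    by (simp add: ennreal_mult[symmetric] exp_add[symmetric])
  then have dom: "\<theta> + \<xi> \<in> \<Theta>\<^sub>0"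
    unfolding add_in_finite_domain_iff by (rule less_trans) simp
  have "\<kappa> (\<theta> + \<xi>) - \<kappa> \<theta> < \<xi> \<bullet> t - \<eta>"
    using less unfolding nn_integral_exp_P_finite_domain[OF dom] by (simp add: ennreal_less_iff)
  then show ?thesis using dom by (intro bexI[of _ "\<theta> + \<xi>"]) auto
qed

end

section \<open>The mean map of a steep family\<close>

context laplace_transform
begin

text \<open>This is \<open>exp (\<kappa> \<theta> - \<theta> \<bullet> t)\<close>, with the value
\<open>\<infinity>\<close> outside the domain of \<open>\<kappa>\<close>. As an integral it is
accessible to Fatou's lemma on the whole space.\<close>

definition shifted :: "'a \<Rightarrow> 'a \<Rightarrow> ennreal" where
  "shifted t \<theta> = (\<integral>\<^sup>+ x. ennreal (exp (\<theta> \<bullet> (x - t))) \<partial>L)"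

lemma shifted_eq_laplace:
  "shifted t \<theta> = ennreal (exp (- (\<theta> \<bullet> t))) * (\<integral>\<^sup>+ x. ennreal (exp (\<theta> \<bullet> x)) \<partial>L)"
  unfolding shifted_def
  by (subst nn_integral_cmult[symmetric])
     (auto intro!: nn_integral_cong simp: ennreal_mult[symmetric] exp_add[symmetric] inner_diff_right)

lemma shifted_finite_iff: "shifted t \<theta> < \<infinity> \<longleftrightarrow> \<theta> \<in> \<Theta>\<^sub>0"
  unfolding shifted_eq_laplace finite_domain_iff
  by (auto simp: ennreal_mult_less_top ennreal_zero_less_mult_iff)

lemma shifted_eq_exp:
  "\<theta> \<in> \<Theta>\<^sub>0 \<Longrightarrow> shifted t \<theta> = ennreal (exp (\<kappa> \<theta> - \<theta> \<bullet> t))"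
  unfolding shifted_eq_laplace
  by (simp add: laplace_eq_exp_cumulant ennreal_mult[symmetric] exp_add[symmetric])

lemma shifted_lower_semicontinuous:
  assumes "s \<longlonglongrightarrow> \<theta>"
  shows "shifted t \<theta> \<le> liminf (\<lambda>k. shifted t (s k))"
proof -
  have "shifted t \<theta> = (\<integral>\<^sup>+ x. liminf (\<lambda>k. ennreal (exp (s k \<bullet> (x - t)))) \<partial>L)"
    unfolding shifted_def
  proof (rule nn_integral_cong)
    fix x
    have "(\<lambda>k. ennreal (exp (s k \<bullet> (x - t)))) \<longlonglongrightarrow> ennreal (exp (\<theta> \<bullet> (x - t)))"
      by (intro tendsto_ennrealI tendsto_intros assms)
    then show "ennreal (exp (\<theta> \<bullet> (x - t))) = liminf (\<lambda>k. ennreal (exp (s k \<bullet> (x - t))))"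
      by (intro lim_imp_Liminf[symmetric]) auto
  qed
  also have "\<dots> \<le> liminf (\<lambda>k. shifted t (s k))"
    unfolding shifted_def by (rule nn_integral_liminf) auto
  finally show ?thesis .
qed

lemma halfspace_not_null:
  assumes t: "t \<in> mean_domain L" and "u \<noteq> 0"
  shows "emeasure L {x. u \<bullet> t < u \<bullet> x} \<noteq> 0"
proof
  assume "emeasure L {x. u \<bullet> t < u \<bullet> x} = 0"
  moreover have "- {x. u \<bullet> x \<le> u \<bullet> t} = {x. u \<bullet> t < u \<bullet> x}" by auto
  ultimately have "convex_support L \<subseteq> {x. u \<bullet> x \<le> u \<bullet> t}"
    by (intro convex_support_subset) (auto simp: closed_halfspace_le convex_halfspace_le)
  moreover obtain e where e: "e > 0" "cball t e \<subseteq> convex_support L"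
    using t by (auto simp: mean_domain_def mem_interior_cball)
  moreover have "t + (e / norm u) *\<^sub>R u \<in> cball t e"
    using \<open>u \<noteq> 0\<close> e by (simp add: dist_norm)
  ultimately have "t + (e / norm u) *\<^sub>R u \<in> {x. u \<bullet> x \<le> u \<bullet> t}"
    by blast
  then have "(e / norm u) * (u \<bullet> u) \<le> 0" by (simp add: inner_add_right)
  moreover have "0 < (e / norm u) * (u \<bullet> u)" using e \<open>u \<noteq> 0\<close> by simp
  ultimately show False by simp
qed

text \<open>Otherwise there are parameters with \<open>shifted t \<theta> \<le> c\<close> whose
norms tend to infinity and whose directions tend to some \<open>u\<close>. Then the integrand tends
to infinity on the half-space \<open>u \<bullet> t < u \<bullet> x\<close>, which is not null
because \<open>t\<close> is interior to the convex support, and Fatou's lemma contradicts the bound.\<close>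

lemma shifted_coercive:
  assumes t: "t \<in> mean_domain L" and c: "c < \<infinity>"
  shows "\<exists>R. \<forall>\<theta>. shifted t \<theta> \<le> c \<longrightarrow> norm \<theta> \<le> R"
proof (rule ccontr)
  assume "\<not> ?thesis"
  then have "\<forall>k::nat. \<exists>\<theta>. shifted t \<theta> \<le> c \<and> real k + 1 < norm \<theta>" by (meson not_le)
  then obtain s where s: "\<And>k. shifted t (s k) \<le> c" "\<And>k. real k + 1 < norm (s k)" by metis
  have "compact (sphere (0::'a) 1)" by simp
  moreover have "\<forall>k. s k /\<^sub>R norm (s k) \<in> sphere 0 1"
  proof
    fix k
    have "norm (s k) \<noteq> 0" using s(2)[of k] by linarith
    then show "s k /\<^sub>R norm (s k) \<in> sphere 0 1" by (simp add: field_simps)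
  qed
  ultimately obtain u and \<sigma> :: "nat \<Rightarrow> nat" where u: "u \<in> sphere 0 1" "strict_mono \<sigma>"
    "((\<lambda>k. s k /\<^sub>R norm (s k)) \<circ> \<sigma>) \<longlonglongrightarrow> u"
    using seq_compactE[OF compact_imp_seq_compact, of "sphere 0 1" "\<lambda>k. s k /\<^sub>R norm (s k)"] by metis
  have norm_top: "filterlim (\<lambda>k. norm (s (\<sigma> k))) at_top sequentially"
  proof (rule filterlim_at_top_mono[OF filterlim_real_sequentially])
    show "\<forall>\<^sub>F k in sequentially. real k \<le> norm (s (\<sigma> k))"
    proof (rule always_eventually, rule allI)
      fix k
      have "real k \<le> real (\<sigma> k)" using seq_suble[OF u(2), of k] by simp
      then show "real k \<le> norm (s (\<sigma> k))" using s(2)[of "\<sigma> k"] by simp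
    qed
  qed
  define S where "S = {x. u \<bullet> t < u \<bullet> x}"
  have "u \<noteq> 0" using u(1) by auto
  have S: "emeasure L S \<noteq> 0" "S \<in> sets L"
    using halfspace_not_null[OF t \<open>u \<noteq> 0\<close>] by (auto simp: S_def sets_L)
  have top: "liminf (\<lambda>k. ennreal (exp (s (\<sigma> k) \<bullet> (x - t)))) = \<infinity>" if "x \<in> S" for x
  proof -
    have "(\<lambda>k. (s (\<sigma> k) /\<^sub>R norm (s (\<sigma> k))) \<bullet> (x - t)) \<longlonglongrightarrow> u \<bullet> (x - t)"
      using u(3) by (intro tendsto_inner tendsto_const) (simp add: o_def)
    moreover have "0 < u \<bullet> (x - t)" using that by (simp add: S_def inner_diff_right)
    ultimately have "filterlim (\<lambda>k. (s (\<sigma> k) /\<^sub>R norm (s (\<sigma> k))) \<bullet> (x - t) * norm (s (\<sigma> k))) at_top sequentially"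
      using norm_top by (rule filterlim_tendsto_pos_mult_at_top)
    moreover have "(s k /\<^sub>R norm (s k)) \<bullet> (x - t) * norm (s k) = s k \<bullet> (x - t)" for k
    proof -
      have "norm (s k) \<noteq> 0" using s(2)[of k] by linarith
      then show ?thesis by (simp add: divide_simps)
    qed
    ultimately have "filterlim (\<lambda>k. s (\<sigma> k) \<bullet> (x - t)) at_top sequentially" by (simp only:)
    then have "filterlim (\<lambda>k. exp (s (\<sigma> k) \<bullet> (x - t))) at_top sequentially"
      by (rule filterlim_compose[OF exp_at_top])
    then have "(\<lambda>k. ennreal (exp (s (\<sigma> k) \<bullet> (x - t)))) \<longlonglongrightarrow> \<infinity>"
      by (simp add: ennreal_tendsto_top_eq_at_top)
    then show ?thesis by (intro lim_imp_Liminf) auto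
  qed
  have "\<infinity> = \<infinity> * emeasure L S" using S by (simp add: ennreal_top_mult)
  also have "\<dots> = (\<integral>\<^sup>+ x. \<infinity> * indicator S x \<partial>L)"
    using S by (simp add: nn_integral_cmult_indicator)
  also have "\<dots> \<le> (\<integral>\<^sup>+ x. liminf (\<lambda>k. ennreal (exp (s (\<sigma> k) \<bullet> (x - t)))) \<partial>L)"
    using top by (intro nn_integral_mono) (auto simp: indicator_def)
  also have "\<dots> \<le> liminf (\<lambda>k. shifted t (s (\<sigma> k)))"
    unfolding shifted_def by (rule nn_integral_liminf) auto
  also have "\<dots> \<le> liminf (\<lambda>k. c)" using s(1) by (intro Liminf_mono) auto
  also have "\<dots> = c" by (simp add: Liminf_const)
  finally show False using c by simp
qed

lemma conjugate_maximizer_exists: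
  assumes t: "t \<in> mean_domain L" and \<theta>1: "\<theta>1 \<in> \<Theta>\<^sub>0"
  obtains \<theta> where "\<theta> \<in> \<Theta>\<^sub>0" "\<And>y. y \<in> \<Theta>\<^sub>0 \<Longrightarrow> \<kappa> \<theta> - \<theta> \<bullet> t \<le> \<kappa> y - y \<bullet> t"
proof -
  define m where "m = Inf (range (shifted t))"
  have m_le: "m \<le> shifted t \<theta>" for \<theta> by (auto simp: m_def intro: Inf_lower)
  have m_fin: "m < \<infinity>" using le_less_trans[OF m_le] shifted_finite_iff \<theta>1 by blast
  obtain f :: "nat \<Rightarrow> ennreal" where f: "decseq f" "range f \<subseteq> range (shifted t)" "m = (INF i. f i)"
    unfolding m_def using ennreal_Inf_countable_INF[of "range (shifted t)"] by auto
  have "f k \<in> range (shifted t)" for k using f(2) by auto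
  then have "\<forall>k. \<exists>\<theta>. f k = shifted t \<theta>" by (simp add: image_iff)
  then obtain s where s: "\<And>k. f k = shifted t (s k)" by metis
  obtain N where N: "f N < \<infinity>" using m_fin f(3) by (auto simp: INF_less_iff)
  obtain R where R: "\<And>\<theta>. shifted t \<theta> \<le> f N \<Longrightarrow> norm \<theta> \<le> R"
    using shifted_coercive[OF t N] by blast
  have "s (k + N) \<in> cball 0 R" for k
    using R[of "s (k + N)"] decseqD[OF f(1), of N "k + N"] s[of "k + N"] by simp
  moreover have "compact (cball (0::'a) R)" by simp
  ultimately obtain \<theta> and \<sigma> :: "nat \<Rightarrow> nat" where \<theta>: "strict_mono \<sigma>" "((\<lambda>k. s (k + N)) \<circ> \<sigma>) \<longlonglongrightarrow> \<theta>"
    using seq_compactE[OF compact_imp_seq_compact, of "cball 0 R" "\<lambda>k. s (k + N)"] by metis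
  have "f \<longlonglongrightarrow> m" unfolding f(3) by (rule LIMSEQ_INF[OF f(1)])
  then have "((\<lambda>k. f (k + N)) \<circ> \<sigma>) \<longlonglongrightarrow> m"
    by (intro LIMSEQ_subseq_LIMSEQ[OF _ \<theta>(1)] LIMSEQ_ignore_initial_segment)
  then have "liminf (\<lambda>k. shifted t (s (\<sigma> k + N))) = m"
    using s by (intro lim_imp_Liminf) (auto simp: o_def)
  then have min: "shifted t \<theta> \<le> m"
    using shifted_lower_semicontinuous[of "\<lambda>k. s (\<sigma> k + N)" \<theta> t] \<theta>(2) by (simp add: o_def)
  then have dom: "\<theta> \<in> \<Theta>\<^sub>0" using m_fin shifted_finite_iff by (metis le_less_trans)
  moreover have "\<kappa> \<theta> - \<theta> \<bullet> t \<le> \<kappa> y - y \<bullet> t" if "y \<in> \<Theta>\<^sub>0" for y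
    using order_trans[OF min m_le[of y]] that dom by (simp add: shifted_eq_exp)
  ultimately show ?thesis using that by blast
qed

text \<open>Suppose that the minimizer \<open>\<theta>\<close> is on the boundary and approach it
along the segment from an interior point \<open>\<theta>1\<close>. Minimality bounds the derivative
of \<open>\<kappa>\<close> in the direction \<open>d = \<theta>1 - \<theta>\<close> from below. The
tangent inequality, tested on a ball around \<open>\<theta>1\<close> where \<open>\<kappa>\<close>
is bounded, bounds \<open>r\<close> times the norm of the gradient plus a nonnegative multiple of
this directional derivative from above. So the gradients stay bounded, against steepness.\<close>

lemma steep_minimizer_interior:
  assumes steep: "steep L" and \<theta>: "\<theta> \<in> \<Theta>\<^sub>0"
    and min: "\<And>y. y \<in> \<Theta>\<^sub>0 \<Longrightarrow> \<kappa> \<theta> - \<theta> \<bullet> t \<le> \<kappa> y - y \<bullet> t"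
  shows "\<theta> \<in> interior \<Theta>\<^sub>0"
proof (rule ccontr)
  assume "\<theta> \<notin> interior \<Theta>\<^sub>0"
  then have front: "\<theta> \<in> frontier \<Theta>\<^sub>0" using \<theta> closure_subset by (auto simp: frontier_def)
  obtain \<theta>1 where \<theta>1: "\<theta>1 \<in> interior \<Theta>\<^sub>0" using steep by (auto simp: steep_def)
  then obtain r where r: "r > 0" "cball \<theta>1 r \<subseteq> interior \<Theta>\<^sub>0"
    by (metis interior_interior mem_interior_cball)
  have "continuous_on (interior \<Theta>\<^sub>0) \<kappa>"
    using GDERIV_cumulant unfolding gderiv_def
    by (intro continuous_at_imp_continuous_on ballI) (blast intro: has_derivative_continuous)
  then have "bounded (\<kappa> ` cball \<theta>1 r)"
    using r by (intro compact_imp_bounded compact_continuous_image) (auto intro: continuous_on_subset)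
  then obtain K where K: "\<And>y. y \<in> cball \<theta>1 r \<Longrightarrow> \<kappa> y \<le> K"
    unfolding bounded_iff by (metis abs_le_D1 image_eqI real_norm_def)
  define d where "d = \<theta>1 - \<theta>"
  define s where "s k = inverse (real (Suc k))" for k
  define y where "y k = \<theta> + s k *\<^sub>R d" for k
  have s: "0 < s k" "s k \<le> 1" for k by (auto simp: s_def field_simps)
  have y: "y k \<in> interior \<Theta>\<^sub>0" for k
  proof -
    have "\<theta> - s k *\<^sub>R (\<theta> - \<theta>1) \<in> interior \<Theta>\<^sub>0"
      using convex_finite_domain \<theta>1 \<theta> s by (intro mem_interior_convex_shrink) auto
    then show ?thesis by (simp add: y_def d_def algebra_simps)
  qed
  have "s \<longlonglongrightarrow> 0" unfolding s_def by (rule LIMSEQ_inverse_real_of_nat)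
  then have "y \<longlonglongrightarrow> \<theta> + 0 *\<^sub>R d" unfolding y_def by (intro tendsto_intros)
  then have "filterlim (\<lambda>k. norm (grad_cumulant L (y k))) at_top sequentially"
    using steep front y unfolding steep_def by auto
  then have grows: "filterlim (\<lambda>k. norm (mean (y k))) at_top sequentially"
    using y by (simp add: grad_cumulant_eq_mean)
  have "r * norm (mean (y k)) \<le> K - \<kappa> \<theta> + 2 * \<bar>d \<bullet> t\<bar>" for k
  proof -
    define m where "m = mean (y k)"
    have yd: "y k \<in> \<Theta>\<^sub>0" using y interior_subset by blast
    have "\<kappa> (y k) + (\<theta> - y k) \<bullet> m \<le> \<kappa> \<theta>"
      unfolding m_def by (rule cumulant_above_tangent[OF y \<theta>])
    moreover have lower: "\<kappa> \<theta> + s k * (d \<bullet> t) \<le> \<kappa> (y k)"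
      using min[OF yd] by (simp add: y_def inner_add_left)
    ultimately have "s k * (d \<bullet> t) \<le> s k * (d \<bullet> m)" by (simp add: y_def)
    then have dm: "d \<bullet> t \<le> d \<bullet> m" using s by (simp add: mult_le_cancel_left_pos)
    \<comment> \<open>The point of the ball at which the tangent at \<open>y k\<close> is highest.\<close>
    define z where "z = \<theta>1 + r *\<^sub>R sgn m"
    have z: "z \<in> cball \<theta>1 r" using r by (simp add: z_def dist_norm norm_sgn)
    have "\<kappa> (y k) + (z - y k) \<bullet> m \<le> K"
      using cumulant_above_tangent[OF y, of z k] K[OF z] z r interior_subset unfolding m_def by force
    moreover have "(z - y k) \<bullet> m = (1 - s k) * (d \<bullet> m) + r * norm m"
    proof -
      have "sgn m \<bullet> m = norm m"
        by (cases "m = 0") (auto simp: sgn_div_norm dot_square_norm power2_eq_square)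
      moreover have "z - y k = (1 - s k) *\<^sub>R d + r *\<^sub>R sgn m"
        by (simp add: z_def y_def d_def algebra_simps)
      ultimately show ?thesis by (simp add: inner_add_left)
    qed
    moreover have "(1 - s k) * (d \<bullet> t) \<le> (1 - s k) * (d \<bullet> m)"
      using s dm by (intro mult_left_mono) auto
    moreover have "- \<bar>d \<bullet> t\<bar> \<le> c * (d \<bullet> t)" if "0 \<le> c" "c \<le> 1" for c
    proof -
      have "\<bar>c * (d \<bullet> t)\<bar> \<le> \<bar>d \<bullet> t\<bar>"
        using that by (simp add: abs_mult mult_left_le_one_le)
      then show ?thesis by linarith
    qed
    note this[of "s k"] this[of "1 - s k"]
    ultimately show ?thesis using lower s[of k] unfolding m_def by linarith
  qed
  then have "norm (mean (y k)) \<le> (K - \<kappa> \<theta> + 2 * \<bar>d \<bullet> t\<bar>) / r" for k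
    using r by (simp add: field_simps)
  moreover obtain k where "(K - \<kappa> \<theta> + 2 * \<bar>d \<bullet> t\<bar>) / r + 1 \<le> norm (mean (y k))"
    using grows unfolding filterlim_at_top eventually_sequentially by blast
  ultimately show False by (meson less_add_one not_le order_trans)
qed

text \<open>The gradient of \<open>\<kappa>\<close> at an interior minimizer of
\<open>\<kappa> \<theta> - \<theta> \<bullet> t\<close> is \<open>t\<close>.\<close>

lemma steep_mean_surjective:
  assumes steep: "steep L" and t: "t \<in> mean_domain L"
  obtains \<theta> where "\<theta> \<in> interior \<Theta>\<^sub>0" "mean \<theta> = t"
proof -
  obtain \<theta>1 where "\<theta>1 \<in> \<Theta>\<^sub>0" using steep interior_subset by (fastforce simp: steep_def)
  then obtain \<theta> where \<theta>: "\<theta> \<in> \<Theta>\<^sub>0" and min: "\<And>y. y \<in> \<Theta>\<^sub>0 \<Longrightarrow> \<kappa> \<theta> - \<theta> \<bullet> t \<le> \<kappa> y - y \<bullet> t"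
    using conjugate_maximizer_exists[OF t] by blast
  have int: "\<theta> \<in> interior \<Theta>\<^sub>0" by (rule steep_minimizer_interior[OF steep \<theta> min])
  moreover have "mean \<theta> = t"
  proof (rule ccontr)
    assume "mean \<theta> \<noteq> t"
    then obtain \<zeta> where "\<theta> + \<zeta> \<in> \<Theta>\<^sub>0" "0 < \<zeta> \<bullet> t - (\<kappa> (\<theta> + \<zeta>) - \<kappa> \<theta>)"
      using GDERIV_above_tangent[OF GDERIV_cumulant[OF int] _ int, of t] by auto
    then show False using min[of "\<theta> + \<zeta>"] by (simp add: inner_add_left)
  qed
  ultimately show ?thesis using that by blast
qed

end

section \<open>Large deviations of the estimator\<close>

lemma (in laplace_transform) sample_mean_exponential_moment:
  assumes "prob_space M" and indep: "prob_space.indep_vars M (\<lambda>_. borel) X UNIV"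
    and law: "\<And>i. distr M borel (X i) = P \<theta>"
    and n: "n \<ge> 1" and \<xi>: "\<theta> + \<xi> \<in> \<Theta>\<^sub>0"
  shows "(\<integral>\<^sup>+ x. ennreal (exp (real n * (\<xi> \<bullet> x))) \<partial>distr M borel (sample_mean X n))
    = ennreal (exp (real n * (\<kappa> (\<theta> + \<xi>) - \<kappa> \<theta>)))"
proof -
  interpret prob_space M by fact
  have X [measurable]: "X i \<in> borel_measurable M" for i
    using indep by (auto simp: indep_vars_def)
  have "(\<integral>\<^sup>+ x. ennreal (exp (real n * (\<xi> \<bullet> x))) \<partial>distr M borel (sample_mean X n))
      = (\<integral>\<^sup>+ \<omega>. (\<Prod>i<n. ennreal (exp (\<xi> \<bullet> X i \<omega>))) \<partial>M)"
    using n unfolding sample_mean_def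
    by (subst nn_integral_distr) (auto simp: inner_sum_right exp_sum prod_ennreal)
  also have "\<dots> = (\<Prod>i<n. \<integral>\<^sup>+ \<omega>. ennreal (exp (\<xi> \<bullet> X i \<omega>)) \<partial>M)"
  proof (rule indep_vars_nn_integral)
    have "indep_vars (\<lambda>_. borel) X {..<n}" by (rule indep_vars_subset[OF indep]) simp
    then show "indep_vars (\<lambda>_. borel) (\<lambda>i \<omega>. ennreal (exp (\<xi> \<bullet> X i \<omega>))) {..<n}"
      by (rule indep_vars_compose2) measurable
  qed auto
  also have "\<dots> = (\<Prod>i<n. \<integral>\<^sup>+ x. ennreal (exp (\<xi> \<bullet> x)) \<partial>distr M borel (X i))"
    by (intro prod.cong refl nn_integral_distr[symmetric]) auto
  also have "\<dots> = ennreal (exp (real n * (\<kappa> (\<theta> + \<xi>) - \<kappa> \<theta>)))"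
    unfolding law by (simp add: nn_integral_exp_P_finite_domain[OF \<xi>] ennreal_power exp_of_nat_mult)
  finally show ?thesis .
qed

theorem theorem3p1:
  fixes L :: "'a::euclidean_space measure"
    and M :: "'w measure"
    and X :: "nat \<Rightarrow> 'w \<Rightarrow> 'a"
    and \<theta>0 :: 'a and \<Theta> :: "'a set" and \<phi> :: "'a \<Rightarrow> 'a"
  assumes "sets L = sets borel" and "sigma_finite_measure L"
    and "not_affinely_concentrated L"
    and "steep L"
    and "\<theta>0 \<in> interior (finite_domain L)"
    and "prob_space M"
    and "prob_space.indep_vars M (\<lambda>_. borel) X UNIV"
    and "\<And>i. distr M borel (X i) = exp_family L \<theta>0"
    and "\<And>n. n \<ge> 1 \<Longrightarrow> AE \<omega> in M. sample_mean X n \<omega> \<in> mean_domain L"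
    and "closedin (top_of_set (finite_domain L)) \<Theta>"
    and "continuous_on (mean_domain L) \<phi>"
    and "\<phi> \<in> mean_domain L \<rightarrow> \<Theta> \<inter> interior (finite_domain L)"
    and "constrained_MLE L \<Theta> \<phi>"
  shows "large_deviation_principle
           (top_of_set (\<Theta> \<inter> interior (finite_domain L)))
           (estimator_law M X L (\<Theta> \<inter> interior (finite_domain L)) \<phi>)
           (mle_rate L \<theta>0 \<phi>)"
proof -
  \<comment> \<open>The empty set is affine, so the measure cannot vanish.\<close>
  have "affine ({} :: 'a set)" "({} :: 'a set) \<noteq> UNIV" by auto
  then have "emeasure L (- {}) \<noteq> 0"
    using assms(3) unfolding not_affinely_concentrated_def by blast
  then interpret laplace_transform L by unfold_locales (use assms(1) in auto)
  interpret M: prob_space M by fact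
  note \<theta>0 = assms(5)
  have X [measurable]: "X i \<in> borel_measurable M" for i
    using assms(7) by (auto simp: M.indep_vars_def)
  have mean_meas [measurable]: "sample_mean X n \<in> borel_measurable M" for n
    unfolding sample_mean_def by measurable
  define U where "U = mean_domain L"
  have U: "open U" by (simp add: U_def mean_domain_def)
  define \<mu> where "\<mu> n = distr M borel (sample_mean X n)" for n
  define D where "D = {\<xi>. \<theta>0 + \<xi> \<in> \<Theta>\<^sub>0}"
  define \<Lambda> where "\<Lambda> \<xi> = \<kappa> (\<theta>0 + \<xi>) - \<kappa> \<theta>0" for \<xi>
  have int_D: "\<theta> - \<theta>0 \<in> interior D" if "\<theta> \<in> interior \<Theta>\<^sub>0" for \<theta>
  proof -
    have "D = (+) (- \<theta>0) ` \<Theta>\<^sub>0"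
      by (auto simp: D_def image_iff intro!: bexI[of _ "\<theta>0 + _"])
    then have "interior D = (+) (- \<theta>0) ` interior \<Theta>\<^sub>0" by (simp only: interior_translation)
    then show ?thesis using that by auto
  qed
  interpret exponential_moments \<mu> D \<Lambda>
  proof (rule exponential_moments.intro)
    show "0 \<in> interior D" using int_D[OF \<theta>0] by simp
    show "prob_space (\<mu> n)" for n unfolding \<mu>_def by (rule M.prob_space_distr) measurable
    show "sets (\<mu> n) = sets borel" for n by (simp add: \<mu>_def)
    show "(\<integral>\<^sup>+ x. ennreal (exp (real n * (\<xi> \<bullet> x))) \<partial>\<mu> n) = ennreal (exp (real n * \<Lambda> \<xi>))"
      if "n \<ge> 1" "\<xi> \<in> D" for n \<xi>
      unfolding \<mu>_def \<Lambda>_def using that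
      by (intro sample_mean_exponential_moment[OF assms(6,7,8)]) (auto simp: D_def)
  qed
  have null: "emeasure (\<mu> n) (- U) = 0" if n: "n \<ge> 1" for n
  proof -
    have "emeasure (\<mu> n) (- U) = emeasure M (sample_mean X n -` (- U) \<inter> space M)"
      unfolding \<mu>_def using U by (intro emeasure_distr) auto
    also have "\<dots> = emeasure M {\<omega> \<in> space M. \<not> sample_mean X n \<omega> \<in> U}"
      by (rule arg_cong[where f="emeasure M"]) auto
    also have "\<dots> = 0"
      using assms(9)[OF n] by (intro emeasure_eq_0_AE) (simp add: U_def)
    finally show ?thesis .
  qed
  \<comment> \<open>The sample mean of size one has law \<open>P \<theta>0\<close>, which has the same null sets as \<open>L\<close>.\<close>
  have "\<mu> 1 = P \<theta>0"
    using assms(8)[of 0] by (simp add: \<mu>_def sample_mean_def[abs_def])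
  then have "emeasure (P \<theta>0) (- U) = 0" using null[of 1] by simp
  then have "AE x in P \<theta>0. x \<in> U"
    using U by (intro AE_I[of _ _ "- U"]) (auto simp: sets_P)
  then have "AE x in L. x \<in> U" by (simp add: AE_P_iff)
  then have full: "emeasure L (- mean_domain L) = 0"
    using U by (subst (asm) AE_iff_measurable[of "- U"]) (auto simp: sets_L space_L U_def)
  have rate_mean: "rate (mean \<theta>) = ereal ((\<theta> - \<theta>0) \<bullet> mean \<theta> - \<Lambda> (\<theta> - \<theta>0))"
    if \<theta>: "\<theta> \<in> interior \<Theta>\<^sub>0" for \<theta>
    unfolding rate_def
  proof (rule antisym)
    show "ereal ((\<theta> - \<theta>0) \<bullet> mean \<theta> - \<Lambda> (\<theta> - \<theta>0)) \<le> (SUP \<xi>\<in>D. ereal (\<xi> \<bullet> mean \<theta> - \<Lambda> \<xi>))"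
      using int_D[OF \<theta>] interior_subset by (intro SUP_upper) blast
    show "(SUP \<xi>\<in>D. ereal (\<xi> \<bullet> mean \<theta> - \<Lambda> \<xi>)) \<le> ereal ((\<theta> - \<theta>0) \<bullet> mean \<theta> - \<Lambda> (\<theta> - \<theta>0))"
    proof (rule SUP_least)
      fix \<xi> assume "\<xi> \<in> D"
      then have "\<kappa> \<theta> + (\<theta>0 + \<xi> - \<theta>) \<bullet> mean \<theta> \<le> \<kappa> (\<theta>0 + \<xi>)"
        by (intro cumulant_above_tangent[OF \<theta>]) (simp add: D_def)
      then show "ereal (\<xi> \<bullet> mean \<theta> - \<Lambda> \<xi>) \<le> ereal ((\<theta> - \<theta>0) \<bullet> mean \<theta> - \<Lambda> (\<theta> - \<theta>0))"
        by (simp add: \<Lambda>_def inner_add_left inner_diff_left)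
    qed
  qed
  have "large_deviation_principle (top_of_set (\<Theta> \<inter> interior \<Theta>\<^sub>0))
    (\<lambda>n. distr (restrict_space (\<mu> n) U) (restrict_space borel (\<Theta> \<inter> interior \<Theta>\<^sub>0)) \<phi>)
    (\<lambda>y. INF t\<in>{t\<in>U. \<phi> t = y}. rate t)"
  proof (rule large_deviations_continuous_image[OF U null])
    show "rate t = \<infinity>" if t: "t \<notin> U" for t
    proof (rule ereal_top)
      fix \<eta> :: real
      obtain y where y: "y \<in> \<Theta>\<^sub>0" "\<eta> < (y - \<theta>0) \<bullet> t - (\<kappa> y - \<kappa> \<theta>0)"
        using conjugate_infinite_outside_mean_domain[OF full subsetD[OF interior_subset \<theta>0], of t \<eta>] t
        by (auto simp: U_def)
      then have "y - \<theta>0 \<in> D" "\<eta> < (y - \<theta>0) \<bullet> t - \<Lambda> (y - \<theta>0)" by (auto simp: D_def \<Lambda>_def)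
      then have "ereal \<eta> < rate t" unfolding less_rate_iff by blast
      then show "ereal \<eta> \<le> rate t" by simp
    qed
    show "\<exists>\<xi>\<in>interior D. GDERIV \<Lambda> \<xi> :> t \<and> rate t = ereal (\<xi> \<bullet> t - \<Lambda> \<xi>)" if t: "t \<in> U" for t
    proof -
      obtain \<theta> where \<theta>: "\<theta> \<in> interior \<Theta>\<^sub>0" "mean \<theta> = t"
        using steep_mean_surjective[OF assms(4)] t unfolding U_def by blast
      have "(\<kappa> has_derivative (\<lambda>h. h \<bullet> t)) (at (\<theta>0 + (\<theta> - \<theta>0)))"
        using GDERIV_cumulant[OF \<theta>(1)] \<theta>(2) by (simp add: gderiv_def)
      then have "((\<lambda>\<xi>. \<kappa> (\<theta>0 + \<xi>)) has_derivative (\<lambda>h. h \<bullet> t)) (at (\<theta> - \<theta>0))"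
        by (rule has_derivative_compose[rotated]) (auto intro!: derivative_eq_intros)
      then have "GDERIV \<Lambda> (\<theta> - \<theta>0) :> t"
        unfolding gderiv_def \<Lambda>_def by (auto intro!: derivative_eq_intros)
      then show ?thesis using rate_mean[OF \<theta>(1)] int_D[OF \<theta>(1)] \<theta>(2) by auto
    qed
  qed (use assms(11,12) in \<open>simp_all add: U_def\<close>)
  moreover have "mle_rate L \<theta>0 \<phi> = (\<lambda>y. INF t\<in>{t\<in>U. \<phi> t = y}. rate t)"
  proof
    fix y
    have "(\<lambda>\<theta>. ereal (kl_div L \<theta> \<theta>0)) ` T_set L \<phi> y = (\<lambda>\<theta>. rate (mean \<theta>)) ` T_set L \<phi> y"
      by (rule image_cong) (auto simp: T_set_def rate_mean kl_div_eq[OF assms(2)] \<Lambda>_def)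
    also have "\<dots> = rate ` mean ` T_set L \<phi> y" by (simp add: image_image)
    also have "mean ` T_set L \<phi> y = {t \<in> U. \<phi> t = y}"
    proof (intro equalityI subsetI)
      fix t assume "t \<in> mean ` T_set L \<phi> y"
      then show "t \<in> {t \<in> U. \<phi> t = y}"
        using mean_in_mean_domain[OF full] by (auto simp: T_set_def U_def grad_cumulant_eq_mean)
    next
      fix t assume t: "t \<in> {t \<in> U. \<phi> t = y}"
      then obtain \<theta> where "\<theta> \<in> interior \<Theta>\<^sub>0" "mean \<theta> = t"
        using steep_mean_surjective[OF assms(4), of t] unfolding U_def by blast
      then show "t \<in> mean ` T_set L \<phi> y"
        using t by (auto simp: T_set_def grad_cumulant_eq_mean intro!: image_eqI[of _ _ \<theta>])
    qed
    finally show "mle_rate L \<theta>0 \<phi> y = (INF t\<in>{t\<in>U. \<phi> t = y}. rate t)"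
      by (simp add: mle_rate_def)
  qed
  moreover have "estimator_law M X L (\<Theta> \<inter> interior \<Theta>\<^sub>0) \<phi>
      = (\<lambda>n. distr (restrict_space (\<mu> n) U) (restrict_space borel (\<Theta> \<inter> interior \<Theta>\<^sub>0)) \<phi>)"
    by (simp add: estimator_law_def fun_eq_iff \<mu>_def U_def)
  ultimately show ?thesis by simp
qed

end
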